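(* Assume the setting described in the context (the algorithm, the standing assumptions, $2f$-redundancy), let $\mathcal{T}>1$, and assume that $q_{\mathcal{H}}$ is strongly convex: there is $\mu\in(0,L]$ such that $(y-x)^{T}(\nabla q_{\mathcal{H}}(y)-\nabla q_{\mathcal{H}}(x))\ge \mu\|y-x\|^{2}$ for all $x,y\in\mathbb{R}^{d}$; let $x^{\star}_{\mathcal{H}}$ be the unique minimizer of $q_{\mathcal{H}}$. Let $V_k=\|\bar{x}_k-x^{\star}_{\mathcal{H}}\|^{2}+W_k$. (i) Suppose that the step sizes satisfy, for all $k\ge 0$, $$\alpha_{k}\le \frac{\mu}{8^{4}(L+1)^{4}\mathcal{T}},\qquad \beta_{k}\le \frac{\mu}{12^{4}L^{2}\mathcal{T}},\qquad \frac{\beta_{k}}{\alpha_{k}}\le \frac{\mu}{14^{4}(L+1)^{4}\mathcal{T}}.$$ Then for all $k\ge 0$ $$\mathbb{E}[V_{k+1}]\le \Big(1-\frac{23\mu\mathcal{T}\beta_{k}}{12}+\frac{17L\mathcal{T}\beta_{k}|\mathcal{B}_{k}|}{3|\mathcal{H}|}\Big)\mathbb{E}[V_k]+\frac{150(L+1)^{3}\mathcal{T}^{2}\sigma^{2}\alpha_{k}^{2}}{\mu}+\frac{128(L+1)^{2}\mathcal{T}^{2}\sigma^{2}f\alpha_{k}^{2}}{|\mathcal{H}|}.$$ (ii) If in addition $$\frac{|\mathcal{B}_{k}|}{|\mathcal{H}|}=\frac{f}{N-f}\le\frac{\mu}{3L},$$ and the constants $C_\alpha,C_\beta,h$ in the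 step sizes are chosen such that $$C_{\alpha}\ge \frac{84^{4}(L+1)^{4}}{6\mu^{2}},\qquad C_{\beta}=\frac{72}{\mu\mathcal{T}},\qquad h\ge\max\Big\{\frac{8^{4}(L+1)^{4}\mathcal{T}C_{\alpha}}{\mu},\ \frac{72^{4}L^{2}}{18\mu^{2}}\Big\},$$ then for all $k\ge 0$ $$\mathbb{E}[V_{k+1}]\le \frac{h^{2}\,\mathbb{E}[V_{0}]}{(1+h+k)^{2}}+\frac{150(L+1)^{3}\mathcal{T}^{2}\sigma^{2}C_{\alpha}^{2}}{\mu(1+h+k)}+\frac{128(L+1)^{2}\mathcal{T}^{2}\sigma^{2}fC_{\alpha}^{2}}{(1+h+k)|\mathcal{H}|}.$$
   Context: Setting. There are $N$ agents and a server; $\mathcal{H}$ is the set of honest agents, $|\mathcal{H}|=N-f$, and the other $f$ agents are Byzantine (identities unknown to the server). Each honest agent $i$ has a differentiable function $q^{i}:\mathbb{R}^{d}\to\mathbb{R}$; $q_{\mathcal{H}}(x)=\frac{1}{|\mathcal{H}|}\sum_{i\in\mathcal{H}}q^{i}(x)$. $2f$-redundancy: for every $\mathcal{S}\subset\mathcal{H}$ with $|\mathcal{S}|\ge N-2f$, $\arg\min_x\sum_{i\in\mathcal{S}}q^{i}(x)=\arg\min_x\sum_{i\in\mathcal{H}}q^{i}(x)$. The following consequence (known from prior work) is a standing fact: $\bigcap_{i\in\mathcal{H}}\mathcal{X}_i^{\star}=\mathcal{X}_{\mathcal{H}}^{\star}$, where $\mathcal{X}_i^{\star},\mathcal{X}_{\mathcal{H}}^{\star}$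 are the sets of minimizers of $q^{i},q_{\mathcal{H}}$; in particular $\nabla q^{i}(x_{\mathcal{H}}^{\star})=0$ for all $i\in\mathcal{H}$. Algorithm. Given $\bar{x}_0\in\mathbb{R}^d$, $y^{i}_{0,0}\in\mathbb{R}^d$, an integer $\mathcal{T}\ge 1$ and step sizes $\alpha_k,\beta_k$. At round $k=0,1,2,\dots$: each honest agent $i$ sets $x^{i}_{k,0}=\bar{x}_k$ and (for $k\ge1$) $y^{i}_{k,0}=y^{i}_{k-1,\mathcal{T}}$, and for $t=0,\dots,\mathcal{T}-1$ computes $x^{i}_{k,t+1}=x^{i}_{k,t}-\beta_k y^{i}_{k,t}$, $\;y^{i}_{k,t+1}=(1-\alpha_k)y^{i}_{k,t}+\alpha_k\nabla q^{i}(x^{i}_{k,t};\Delta^{i}_{k,t})$, where $\nabla q^{i}(\cdot;\Delta^{i}_{k,t})$ is a stochastic sample of $\nabla q^{i}(\cdot)$. Each honest agent sends $x^{i}_{k,\mathcal{T}}$ to the server; a Byzantine agent $i$ observes the entire network and sends an arbitrary vector, also denoted $x^{i}_{k,\mathcal{T}}$. The server sorts the distances $\|\bar{x}_k-x^{i}_{k,\mathcal{T}}\|$ in ascending order, discards the $f$ agents with the largest distances, lets $\mathcal{F}_k$ be the set of the remaining $N-f$ agents, and sets $\bar{x}_{k+1}=\frac{1}{|\mathcal{F}_k|}\sum_{i\in\mathcal{F}_k}x^{i}_{k,\mathcal{T}}$. $\mathcal{B}_k$ is the set of Byzantine agents in $\mathcal{F}_k$ and $\mathcal{H}_k$ the set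 of honest agents in $\mathcal{F}_k$; so $|\mathcal{B}_k|=|\mathcal{H}\setminus\mathcal{H}_k|\le f$. Step sizes: $\alpha_k=\frac{C_\alpha}{1+h+k}$, $\beta_k=\frac{C_\beta}{1+h+k}$ with $h>1$, $0<C_\beta\le C_\alpha$, $\alpha_k\le1$ and $L\mathcal{T}\beta_k\le1$ for all $k\ge0$. Standing assumptions. (Noise) The samples $\Delta^{i}_{k,t}$ are i.i.d.; with $\mathcal{P}_{k,t}$ the $\sigma$-algebra of all random variables generated by the algorithm up to (not including) the sampling of $\Delta_{k,t}^i$ at local step $t$ of round $k$ (so $\bar{x}_k,x^{i}_{k,t},y^{i}_{k,t}$ are $\mathcal{P}_{k,t}$-measurable), for every $x$ (including $\mathcal{P}_{k,t}$-measurable $x$): $\mathbb{E}[\nabla q^{i}(x;\Delta^{i}_{k,t})\mid\mathcal{P}_{k,t}]=\nabla q^{i}(x)$ and $\mathbb{E}[\|\nabla q^{i}(x;\Delta^{i}_{k,t})-\nabla q^{i}(x)\|^{2}\mid\mathcal{P}_{k,t}]\le\sigma^{2}$. (Smoothness) For each $i\in\mathcal{H}$, $\|\nabla q^{i}(y)-\nabla q^{i}(x)\|\le L\|y-x\|$ for all $x,y$, with $L>0$. Notation: $e^{i}_{k,t}=y^{i}_{k,t}-\nabla q^{i}(\bar{x}_k)$ and $W_k=\frac{1}{|\mathcal{H}|}\sum_{i\in\mathcal{H}}\|e^{i}_{k,0}\|^{2}$.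
   Formalization: In (i) |B_k| is random, so the inequality with |B_k| outside the expectation can fail; the factor is kept inside, E[(1-...+...|B_k|)V_k], and the displayed form is stated when |B_k| is almost surely constant. *)

theory Defs
  imports "HOL-Probability.Probability"
begin

definition grad :: "(real ^ 'd \<Rightarrow> real) \<Rightarrow> real ^ 'd \<Rightarrow> real ^ 'd" where
  "grad g x = (THE D. GDERIV g x :> D)"

definition minimizers :: "('v \<Rightarrow> real) \<Rightarrow> 'v set" where
  "minimizers g = {x. is_arg_min g (\<lambda>_. True) x}"

definition avg_cost :: "nat set \<Rightarrow> (nat \<Rightarrow> 'v \<Rightarrow> real) \<Rightarrow> 'v \<Rightarrow> real" where
  "avg_cost H q x = (1 / real (card H)) * (\<Sum>i\<in>H. q i x)"

text \<open>The bound \<open>N - 2 f \<le> card S\<close> is written without truncated subtraction.\<close>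

definition two_f_redundant :: "nat \<Rightarrow> nat \<Rightarrow> nat set \<Rightarrow> (nat \<Rightarrow> 'v \<Rightarrow> real) \<Rightarrow> bool" where
  "two_f_redundant N f H q \<longleftrightarrow>
     (\<forall>S. S \<subseteq> H \<and> N \<le> card S + 2 * f \<longrightarrow>
        minimizers (\<lambda>x. \<Sum>i\<in>S. q i x) = minimizers (\<lambda>x. \<Sum>i\<in>H. q i x))"

text \<open>The library has conditional expectations of real functions only; for vectors they are
  taken componentwise.\<close>

definition vec_cond_exp ::
    "'w measure \<Rightarrow> 'w measure \<Rightarrow> ('w \<Rightarrow> real ^ 'd) \<Rightarrow> 'w \<Rightarrow> real ^ 'd" where
  "vec_cond_exp M A X \<omega> = (\<chi> j. real_cond_exp M A (\<lambda>\<omega>'. X \<omega>' $ j) \<omega>)"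

definition events :: "'w measure \<Rightarrow> ('w \<Rightarrow> 'b) \<Rightarrow> 'b measure \<Rightarrow> 'w set set" where
  "events M X A = {X -` E \<inter> space M | E. E \<in> sets A}"

text \<open>The \<open>\<sigma>\<close>-algebra of everything generated before the samples of local step \<open>t\<close> of round \<open>k\<close>
  are drawn: all earlier samples, the iterates computed so far, and the Byzantine messages
  and server selections of all earlier rounds.\<close>

definition history ::
    "'w measure \<Rightarrow> 'z measure \<Rightarrow> nat \<Rightarrow> nat set \<Rightarrow> nat
     \<Rightarrow> (nat \<Rightarrow> nat \<Rightarrow> nat \<Rightarrow> 'w \<Rightarrow> 'z)
     \<Rightarrow> (nat \<Rightarrow> 'w \<Rightarrow> real ^ 'd)
     \<Rightarrow> (nat \<Rightarrow> nat \<Rightarrow> nat \<Rightarrow> 'w \<Rightarrow> real ^ 'd)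
     \<Rightarrow> (nat \<Rightarrow> nat \<Rightarrow> nat \<Rightarrow> 'w \<Rightarrow> real ^ 'd)
     \<Rightarrow> (nat \<Rightarrow> 'w \<Rightarrow> nat set) \<Rightarrow> nat \<Rightarrow> nat \<Rightarrow> 'w measure" where
  "history M Z N H T \<Delta> xbar x y F k t = sigma (space M)
     ((\<Union>i\<in>H. \<Union>(l, s)\<in>{(l, s). s < T \<and> (l < k \<or> l = k \<and> s < t)}. events M (\<Delta> i l s) Z)
    \<union> (\<Union>i\<in>H. \<Union>(l, s)\<in>{(l, s). s \<le> T \<and> (l < k \<or> l = k \<and> s \<le> t)}.
         events M (x i l s) borel \<union> events M (y i l s) borel)
    \<union> (\<Union>l\<in>{..k}. events M (xbar l) borel)
    \<union> (\<Union>i\<in>{..<N} - H. \<Union>l\<in>{..<k}. events M (x i l T) borel)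
    \<union> (\<Union>l\<in>{..<k}. events M (F l) (count_space UNIV)))"

text \<open>Agents are \<open>{..<N}\<close>. \<open>G i v z\<close> is the stochastic gradient of agent \<open>i\<close> at \<open>v\<close> for sample \<open>z\<close>.
  For a Byzantine agent \<open>i\<close> only \<open>x i k T\<close> (its message in round \<open>k\<close>) is meaningful, an arbitrary
  random vector.

  \<open>F k\<close> is any random set that keeps \<open>N - f\<close> agents with smallest distances, so ties may be
  broken arbitrarily.

  For \<open>f > 0\<close> and differentiable costs, redundancy makes every honest gradient vanish at every
  minimizer of the average cost. For \<open>f = 0\<close> redundancy holds trivially and says nothing about
  the individual costs, so there the common-minimizer property is required separately.

  The mean condition is imposed whenever the sampled gradient is integrable, i.e. whenever its
  conditional expectation is meaningful; the variance condition uses the conditional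
  expectation of nonnegative functions and needs no such proviso.\<close>

locale byzantine_local_sgd = prob_space M
  for M :: "'w measure"
  and Z :: "'z measure"
  and N f :: nat
  and H :: "nat set"
  and q :: "nat \<Rightarrow> real ^ 'd \<Rightarrow> real"
  and G :: "nat \<Rightarrow> real ^ 'd \<Rightarrow> 'z \<Rightarrow> real ^ 'd"
  and \<Delta> :: "nat \<Rightarrow> nat \<Rightarrow> nat \<Rightarrow> 'w \<Rightarrow> 'z"
  and T :: nat
  and L \<sigma> C\<alpha> C\<beta> h :: real
  and \<alpha> \<beta> :: "nat \<Rightarrow> real"
  and x0 :: "real ^ 'd"
  and y0 :: "nat \<Rightarrow> real ^ 'd"
  and xbar :: "nat \<Rightarrow> 'w \<Rightarrow> real ^ 'd"
  and x y :: "nat \<Rightarrow> nat \<Rightarrow> nat \<Rightarrow> 'w \<Rightarrow> real ^ 'd"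
  and F :: "nat \<Rightarrow> 'w \<Rightarrow> nat set" +
  assumes honest_subset: "H \<subseteq> {..<N}"
    and honest_card: "card H + f = N"
    and differentiable: "\<And>i v. i \<in> H \<Longrightarrow> q i differentiable (at v)"
    and L_pos: "L > 0"
    and smooth: "\<And>i u v. i \<in> H \<Longrightarrow> norm (grad (q i) v - grad (q i) u) \<le> L * norm (v - u)"
    and redundancy: "two_f_redundant N f H q"
    and common_minimizers:
      "f = 0 \<Longrightarrow> (\<Inter>i\<in>H. minimizers (q i)) = minimizers (avg_cost H q)"
    and T_ge_1: "T \<ge> 1"
    and h_gt_1: "h > 1"
    and C_bounds: "0 < C\<beta>" "C\<beta> \<le> C\<alpha>"
    and alpha_eq: "\<And>k. \<alpha> k = C\<alpha> / (1 + h + real k)"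
    and beta_eq: "\<And>k. \<beta> k = C\<beta> / (1 + h + real k)"
    and alpha_le_1: "\<And>k. \<alpha> k \<le> 1"
    and beta_le: "\<And>k. L * real T * \<beta> k \<le> 1"
    and init_xbar: "\<And>\<omega>. \<omega> \<in> space M \<Longrightarrow> xbar 0 \<omega> = x0"
    and init_y: "\<And>i \<omega>. i \<in> H \<Longrightarrow> \<omega> \<in> space M \<Longrightarrow> y i 0 0 \<omega> = y0 i"
    and start_x: "\<And>i k \<omega>. i \<in> H \<Longrightarrow> \<omega> \<in> space M \<Longrightarrow> x i k 0 \<omega> = xbar k \<omega>"
    and start_y: "\<And>i k \<omega>. i \<in> H \<Longrightarrow> \<omega> \<in> space M \<Longrightarrow> y i (Suc k) 0 \<omega> = y i k T \<omega>"
    and step_x: "\<And>i k t \<omega>. i \<in> H \<Longrightarrow> t < T \<Longrightarrow> \<omega> \<in> space M \<Longrightarrow>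
      x i k (Suc t) \<omega> = x i k t \<omega> - \<beta> k *\<^sub>R y i k t \<omega>"
    and step_y: "\<And>i k t \<omega>. i \<in> H \<Longrightarrow> t < T \<Longrightarrow> \<omega> \<in> space M \<Longrightarrow>
      y i k (Suc t) \<omega> = (1 - \<alpha> k) *\<^sub>R y i k t \<omega> + \<alpha> k *\<^sub>R G i (x i k t \<omega>) (\<Delta> i k t \<omega>)"
    and byzantine_message: "\<And>i k. i \<in> {..<N} - H \<Longrightarrow> x i k T \<in> borel_measurable M"
    and filter_measurable: "\<And>k. F k \<in> M \<rightarrow>\<^sub>M count_space (Pow {..<N})"
    and filter_card: "\<And>k \<omega>. \<omega> \<in> space M \<Longrightarrow> card (F k \<omega>) = N - f"
    and filter_dist: "\<And>k \<omega> i j. \<omega> \<in> space M \<Longrightarrow> i \<in> F k \<omega> \<Longrightarrow> j \<in> {..<N} - F k \<omega> \<Longrightarrow>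
      norm (xbar k \<omega> - x i k T \<omega>) \<le> norm (xbar k \<omega> - x j k T \<omega>)"
    and server: "\<And>k \<omega>. \<omega> \<in> space M \<Longrightarrow>
      xbar (Suc k) \<omega> = (1 / real (card (F k \<omega>))) *\<^sub>R (\<Sum>i\<in>F k \<omega>. x i k T \<omega>)"
    and G_measurable: "\<And>i. i \<in> H \<Longrightarrow> (\<lambda>(v, z). G i v z) \<in> borel_measurable (borel \<Otimes>\<^sub>M Z)"
    and samples_indep:
      "indep_vars (\<lambda>_. Z) (\<lambda>(i, k, t). \<Delta> i k t) (H \<times> UNIV \<times> {..<T})"
    and samples_identical: "\<And>i k t i' k' t'. i \<in> H \<Longrightarrow> t < T \<Longrightarrow> i' \<in> H \<Longrightarrow> t' < T \<Longrightarrow>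
      distr M Z (\<Delta> i k t) = distr M Z (\<Delta> i' k' t')"
    and noise_mean: "\<And>i k t X. i \<in> H \<Longrightarrow> t < T \<Longrightarrow>
      X \<in> borel_measurable (history M Z N H T \<Delta> xbar x y F k t) \<Longrightarrow>
      integrable M (\<lambda>\<omega>. G i (X \<omega>) (\<Delta> i k t \<omega>)) \<Longrightarrow>
      AE \<omega> in M. vec_cond_exp M (history M Z N H T \<Delta> xbar x y F k t)
        (\<lambda>\<omega>. G i (X \<omega>) (\<Delta> i k t \<omega>)) \<omega> = grad (q i) (X \<omega>)"
    and noise_variance: "\<And>i k t X. i \<in> H \<Longrightarrow> t < T \<Longrightarrow>
      X \<in> borel_measurable (history M Z N H T \<Delta> xbar x y F k t) \<Longrightarrow>
      AE \<omega> in M. nn_cond_exp M (history M Z N H T \<Delta> xbar x y F k t)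
        (\<lambda>\<omega>. ennreal ((norm (G i (X \<omega>) (\<Delta> i k t \<omega>) - grad (q i) (X \<omega>)))\<^sup>2)) \<omega> \<le> ennreal (\<sigma>\<^sup>2)"

definition grad_error ::
    "(nat \<Rightarrow> real ^ 'd \<Rightarrow> real) \<Rightarrow> (nat \<Rightarrow> 'w \<Rightarrow> real ^ 'd)
     \<Rightarrow> (nat \<Rightarrow> nat \<Rightarrow> nat \<Rightarrow> 'w \<Rightarrow> real ^ 'd) \<Rightarrow> nat \<Rightarrow> nat \<Rightarrow> nat \<Rightarrow> 'w \<Rightarrow> real ^ 'd" where
  "grad_error q xbar y i k t \<omega> = y i k t \<omega> - grad (q i) (xbar k \<omega>)"

definition W_fun ::
    "nat set \<Rightarrow> (nat \<Rightarrow> real ^ 'd \<Rightarrow> real) \<Rightarrow> (nat \<Rightarrow> 'w \<Rightarrow> real ^ 'd)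
     \<Rightarrow> (nat \<Rightarrow> nat \<Rightarrow> nat \<Rightarrow> 'w \<Rightarrow> real ^ 'd) \<Rightarrow> nat \<Rightarrow> 'w \<Rightarrow> real" where
  "W_fun H q xbar y k \<omega> =
     (1 / real (card H)) * (\<Sum>i\<in>H. (norm (grad_error q xbar y i k 0 \<omega>))\<^sup>2)"

definition V_fun ::
    "nat set \<Rightarrow> (nat \<Rightarrow> real ^ 'd \<Rightarrow> real) \<Rightarrow> real ^ 'd \<Rightarrow> (nat \<Rightarrow> 'w \<Rightarrow> real ^ 'd)
     \<Rightarrow> (nat \<Rightarrow> nat \<Rightarrow> nat \<Rightarrow> 'w \<Rightarrow> real ^ 'd) \<Rightarrow> nat \<Rightarrow> 'w \<Rightarrow> real" where
  "V_fun H q xs xbar y k \<omega> = (norm (xbar k \<omega> - xs))\<^sup>2 + W_fun H q xbar y k \<omega>"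

text \<open>This is a random set, so a bound whose contraction factor involves its size keeps that factor
  under the expectation; the factor may be taken outside when the size is almost surely constant.\<close>

definition kept_byzantine :: "nat set \<Rightarrow> (nat \<Rightarrow> 'w \<Rightarrow> nat set) \<Rightarrow> nat \<Rightarrow> 'w \<Rightarrow> nat set" where
  "kept_byzantine H F k \<omega> = F k \<omega> - H"

end

theory Submission
  imports Defs
begin

text \<open>Write \<open>e\<^sub>t\<close> for the gradient errors of a round and \<open>d\<close> for the squared distance of the server
  iterate to the minimizer, where all honest gradients vanish. The filter keeps as many Byzantine
  messages as it drops honest ones, and they are no longer than the dropped ones, so their effect
  on the server step is at most twice that of the dropped honest displacements. Each of these has
  size at most \<open>\<beta> \<Sum>\<^sub>t (\<parallel>e\<^sub>t\<parallel> + L \<surd>d)\<close>. Hence, path by path, \<open>d\<close> contracts at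
  rate \<open>2 \<mu> T \<beta>\<close>, less a loss proportional to the number of kept Byzantine agents, up to a small
  multiple of \<open>\<Sum>\<^sub>t \<parallel>e\<^sub>t\<parallel>\<^sup>2\<close>. Since the errors are only ever bounded by sums over all honest agents,
  the dependence of the filter on the noise of the round does no harm. In expectation each local
  step contracts the squared error by \<open>1 - \<alpha>\<close> and adds \<open>\<alpha>\<^sup>2 \<sigma>\<^sup>2\<close>, the noise being orthogonal to the
  past. As \<open>\<beta> / \<alpha>\<close> is small, the contraction of the errors absorbs all cross terms. Part (ii)
  multiplies the resulting recursion by \<open>(1 + h + k)\<^sup>2\<close> and telescopes.\<close>

section \<open>Gradients\<close>

text \<open>The numbers in the rates come from a small ledger. Strong convexity offers the squared
  distance a decrease at rate \<open>2 * \<mu> * T * \<beta>\<close>. One share of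
  \<open>\<mu> / 24\<close> pays for the Young split between distance and gradient errors, a second
  one is held in reserve for the higher-order distance terms, and \<open>23 / 12\<close> is left.
  The Byzantine constant \<open>17 / 3\<close> is \<open>4\<close>, from the gradient part of the
  dropped displacements, plus \<open>5 / 3\<close> from a Young split. In part (ii) the bound on the
  Byzantine fraction turns \<open>17 / 3 * L\<close> into at most \<open>17 / 9 * \<mu>\<close>, and
  \<open>23 / 12 - 17 / 9 = 1 / 36\<close>; with \<open>C\<beta> = 72 / (\<mu> * T)\<close> this is
  the rate \<open>2 / (1 + h + k)\<close>, for which squared weights telescope. Between rounds the
  direction is carried over while the gradient it is compared with moves along with the server
  iterate. This shift has a coefficient of order \<open>1 / (\<alpha> * T)\<close>, affordable only
  because the squared server step is of order \<open>\<beta>\<^sup>2\<close>.\<close>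

lemma grad_eqI:
  assumes "GDERIV g v :> D"
  shows "grad g v = D"
  unfolding grad_def
proof (rule the_equality)
  show "GDERIV g v :> D" by (fact assms)
next
  fix D' assume "GDERIV g v :> D'"
  then have "(\<lambda>u. u \<bullet> D') = (\<lambda>u. u \<bullet> D)"
    using assms unfolding gderiv_def by (rule has_derivative_unique)
  then have "D' \<bullet> D' = D' \<bullet> D" "D \<bullet> D' = D \<bullet> D" by metis+
  then have "(D' - D) \<bullet> (D' - D) = 0" by (simp add: inner_diff inner_commute)
  then show "D' = D" by simp
qed

lemma GDERIV_grad:
  assumes "g differentiable (at v)"
  shows "GDERIV g v :> grad g v"
proof -
  obtain g' where g': "(g has_derivative g') (at v)"
    using assms unfolding differentiable_def by blast
  then interpret bounded_linear g' by (rule has_derivative_bounded_linear)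
  \<comment> \<open>The adjoint of a real functional, evaluated at \<open>1\<close>, is its Riesz
    representative; it supplies the gradient vector.\<close>
  have "g' u = u \<bullet> adjoint g' 1" for u
    using adjoint_works[OF linear_axioms, of u 1] by simp
  then have "GDERIV g v :> adjoint g' 1"
    using g' unfolding gderiv_def by (metis ext)
  then show ?thesis using grad_eqI by metis
qed

lemma GDERIV_sum:
  assumes "\<And>i. i \<in> I \<Longrightarrow> GDERIV (g i) v :> D i"
  shows "GDERIV (\<lambda>u. \<Sum>i\<in>I. g i u) v :> (\<Sum>i\<in>I. D i)"
  using assms unfolding gderiv_def inner_sum_right by (rule has_derivative_sum)

lemma GDERIV_minimizer:
  assumes "v \<in> minimizers g" "GDERIV g v :> D"
  shows "D = 0"
proof -
  have "\<forall>u\<in>UNIV. g v \<le> g u"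
    using assms(1) by (auto simp: minimizers_def is_arg_min_def not_less)
  then have "(\<lambda>u. u \<bullet> D) = (\<lambda>_. 0)"
    using assms(2) unfolding gderiv_def
    by (intro differential_zero_maxmin[of v UNIV g]) auto
  then have "D \<bullet> D = 0" by meson
  then show ?thesis by simp
qed

lemma grad_avg_cost:
  assumes "\<And>i. i \<in> H \<Longrightarrow> q i differentiable (at v)"
  shows "grad (avg_cost H q) v = (1 / real (card H)) *\<^sub>R (\<Sum>i\<in>H. grad (q i) v)"
proof -
  have "GDERIV (\<lambda>u. \<Sum>i\<in>H. q i u) v :> (\<Sum>i\<in>H. grad (q i) v)"
    by (intro GDERIV_sum GDERIV_grad assms)
  from has_derivative_mult_right[OF this[unfolded gderiv_def], of "1 / real (card H)"] show ?thesis
    unfolding avg_cost_def by (intro grad_eqI) (simp add: gderiv_def)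
qed

lemma minimizers_scale:
  assumes "c > (0::real)"
  shows "minimizers (\<lambda>v. c * g v) = minimizers g"
  using assms by (auto simp: minimizers_def is_arg_min_def)

section \<open>Elementary inequalities\<close>

lemma norm_sum_power2_le:
  fixes u :: "nat \<Rightarrow> 'a::real_normed_vector"
  shows "(norm (\<Sum>s<t. u s))\<^sup>2 \<le> real t * (\<Sum>s<t. (norm (u s))\<^sup>2)"
proof -
  have "(norm (\<Sum>s<t. u s))\<^sup>2 \<le> (\<Sum>s<t. norm (u s))\<^sup>2"
    by (intro power_mono norm_sum) auto
  also have "\<dots> \<le> real (card {..<t}) * (\<Sum>s<t. (norm (u s))\<^sup>2)"
    using Cauchy_Schwarz_ineq_sum[of "\<lambda>_. 1" "\<lambda>s. norm (u s)" "{..<t}"] by simp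
  finally show ?thesis by simp
qed

lemma norm_add_power2_le:
  fixes u v :: "'a::real_normed_vector"
  shows "(norm (u + v))\<^sup>2 \<le> 2 * (norm u)\<^sup>2 + 2 * (norm v)\<^sup>2"
proof -
  have "(norm (u + v))\<^sup>2 \<le> (norm u + norm v)\<^sup>2"
    by (intro power_mono norm_triangle_ineq) auto
  also have "\<dots> \<le> 2 * (norm u)\<^sup>2 + 2 * (norm v)\<^sup>2"
    using sum_squares_bound[of "norm u" "norm v"] by (simp add: power2_sum)
  finally show ?thesis .
qed

lemma norm_add_power2_young:
  fixes u v :: "'a::real_normed_vector"
  assumes "\<eta> > 0"
  shows "(norm (u + v))\<^sup>2 \<le> (1 + \<eta>) * (norm u)\<^sup>2 + (1 + 1 / \<eta>) * (norm v)\<^sup>2"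
proof -
  have "(norm (u + v))\<^sup>2 \<le> (norm u + norm v)\<^sup>2"
    by (intro power_mono norm_triangle_ineq) auto
  moreover have "0 \<le> (\<eta> * norm u - norm v)\<^sup>2 / \<eta>" using assms by simp
  moreover have "(\<eta> * norm u - norm v)\<^sup>2 / \<eta>
      = \<eta> * (norm u)\<^sup>2 + (norm v)\<^sup>2 / \<eta> - 2 * norm u * norm v"
    using assms by (simp add: power2_eq_square field_simps)
  ultimately show ?thesis by (simp add: power2_sum algebra_simps)
qed

lemma mult_le_young:
  fixes a b c :: real
  assumes "c > 0"
  shows "2 * a * b \<le> c * a\<^sup>2 + b\<^sup>2 / c"
proof -
  have "0 \<le> (c * a - b)\<^sup>2 / c" using assms by simp
  also have "\<dots> = c * a\<^sup>2 + b\<^sup>2 / c - 2 * a * b"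
    using assms by (simp add: power2_eq_square field_simps)
  finally show ?thesis by simp
qed

text \<open>Jensen's inequality for the squared norm. Applied to the noise-free part of a local step
  it keeps the contraction factor at exactly \<open>1 - a\<close>, without the loss of a Young
  split.\<close>

lemma norm_convex_combination_power2_le:
  fixes u v :: "'a::real_normed_vector"
  assumes "0 \<le> a" "a \<le> 1"
  shows "(norm ((1 - a) *\<^sub>R u + a *\<^sub>R v))\<^sup>2 \<le> (1 - a) * (norm u)\<^sup>2 + a * (norm v)\<^sup>2"
proof -
  have "norm ((1 - a) *\<^sub>R u + a *\<^sub>R v) \<le> (1 - a) * norm u + a * norm v"
    using assms by (intro norm_triangle_le) simp
  then have "(norm ((1 - a) *\<^sub>R u + a *\<^sub>R v))\<^sup>2 \<le> ((1 - a) * norm u + a * norm v)\<^sup>2"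
    by (intro power_mono) auto
  also have "\<dots> = (1 - a) * (norm u)\<^sup>2 + a * (norm v)\<^sup>2 - a * (1 - a) * (norm u - norm v)\<^sup>2"
    by (simp add: power2_eq_square algebra_simps)
  also have "\<dots> \<le> (1 - a) * (norm u)\<^sup>2 + a * (norm v)\<^sup>2"
    using assms by simp
  finally show ?thesis .
qed

text \<open>Any bijection pairs each element with one of at least its value. The intended sets are
  the kept Byzantine and the dropped honest agents.\<close>

lemma sum_le_sum_of_equal_card:
  fixes g :: "'a \<Rightarrow> real"
  assumes "finite A" "finite B" "card A = card B"
    and "\<And>i j. i \<in> A \<Longrightarrow> j \<in> B \<Longrightarrow> g i \<le> g j"
  shows "sum g A \<le> sum g B"
proof -
  obtain \<pi> where \<pi>: "bij_betw \<pi> A B"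
    using finite_same_card_bij[OF assms(1-3)] by blast
  have "sum g A \<le> (\<Sum>i\<in>A. g (\<pi> i))"
    using \<pi> by (intro sum_mono assms(4)) (auto dest: bij_betwE)
  also have "\<dots> = sum g B" by (rule sum.reindex_bij_betw[OF \<pi>])
  finally show ?thesis .
qed

section \<open>Bounds along a single sample path\<close>

context byzantine_local_sgd
begin

abbreviation err :: "nat \<Rightarrow> nat \<Rightarrow> nat \<Rightarrow> 'w \<Rightarrow> real ^ 'd" where
  "err \<equiv> grad_error q xbar y"

text \<open>Extends \<open>W_fun\<close>, the case \<open>t = 0\<close>, to every local step, since
  the errors inside a round feed back into each other.\<close>

definition mean_sq_err :: "nat \<Rightarrow> nat \<Rightarrow> 'w \<Rightarrow> real" where
  "mean_sq_err k t \<omega> = (1 / real (card H)) * (\<Sum>i\<in>H. (norm (err i k t \<omega>))\<^sup>2)"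

lemma finite_H: "finite H"
  using honest_subset finite_subset by blast

lemma alpha_pos: "\<alpha> k > 0"
  using C_bounds h_gt_1 by (simp add: alpha_eq)

lemma beta_pos: "\<beta> k > 0"
  using C_bounds h_gt_1 by (simp add: beta_eq)

lemma mean_sq_err_nonneg: "mean_sq_err k t \<omega> \<ge> 0"
  by (simp add: mean_sq_err_def sum_nonneg)

text \<open>The direction passes unchanged into the next round, but the error is now measured
  against the gradient at the new server iterate; the added difference is this change of
  reference.\<close>

lemma mean_sq_err_Suc_0:
  assumes "\<omega> \<in> space M"
  shows "mean_sq_err (Suc k) 0 \<omega> = (1 / real (card H)) *
    (\<Sum>i\<in>H. (norm (err i k T \<omega> + (grad (q i) (xbar k \<omega>) - grad (q i) (xbar (Suc k) \<omega>))))\<^sup>2)"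
  unfolding mean_sq_err_def grad_error_def using assms
  by (intro arg_cong2[where f="(*)"] sum.cong refl) (simp add: start_y)

lemma local_displacement:
  assumes "i \<in> H" "\<omega> \<in> space M" "t \<le> T"
  shows "x i k t \<omega> - xbar k \<omega> = - \<beta> k *\<^sub>R (\<Sum>s<t. y i k s \<omega>)"
  using assms(3)
proof (induction t)
  case 0
  then show ?case using assms by (simp add: start_x)
next
  case (Suc t)
  then have "x i k t \<omega> = xbar k \<omega> - \<beta> k *\<^sub>R (\<Sum>s<t. y i k s \<omega>)" by (simp add: algebra_simps)
  then show ?case using Suc assms by (simp add: step_x algebra_simps)
qed

section \<open>Size and composition of the kept set\<close>

lemma filter_subset: "\<omega> \<in> space M \<Longrightarrow> F k \<omega> \<subseteq> {..<N}"
  using measurable_space[OF filter_measurable] by auto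

lemma filter_card_H: "\<omega> \<in> space M \<Longrightarrow> card (F k \<omega>) = card H"
  using filter_card honest_card by simp

lemma finite_filter: "\<omega> \<in> space M \<Longrightarrow> finite (F k \<omega>)"
  using filter_subset finite_subset by blast

text \<open>\<open>F k \<omega>\<close> and \<open>H\<close> have the same size, hence so do their
  parts outside the intersection. This is what permits matching kept Byzantine agents with dropped
  honest ones.\<close>

lemma card_kept_byzantine:
  assumes "\<omega> \<in> space M"
  shows "card (F k \<omega> - H) = card (H - F k \<omega>)"
  using card_Diff_subset_Int[of "F k \<omega>" H] card_Diff_subset_Int[of H "F k \<omega>"]
    finite_H finite_filter[OF assms] filter_card_H[OF assms] by (simp add: Int_commute)

lemma card_kept_byzantine_le:
  assumes "\<omega> \<in> space M"
  shows "card (F k \<omega> - H) \<le> f"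
proof -
  have "card (F k \<omega> - H) \<le> card ({..<N} - H)"
    using filter_subset[OF assms] by (intro card_mono) auto
  also have "\<dots> = f"
    using honest_subset honest_card finite_H by (simp add: card_Diff_subset)
  finally show ?thesis .
qed

lemma sum_kept_byzantine_le:
  assumes "\<omega> \<in> space M"
  shows "(\<Sum>i\<in>F k \<omega> - H. norm (x i k T \<omega> - xbar k \<omega>))
    \<le> (\<Sum>i\<in>H - F k \<omega>. norm (x i k T \<omega> - xbar k \<omega>))"
proof (rule sum_le_sum_of_equal_card)
  fix i j assume "i \<in> F k \<omega> - H" "j \<in> H - F k \<omega>"
  then show "norm (x i k T \<omega> - xbar k \<omega>) \<le> norm (x j k T \<omega> - xbar k \<omega>)"
    using filter_dist[OF assms, of i k j] honest_subset by (auto simp: norm_minus_commute)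
qed (use assms finite_H finite_filter card_kept_byzantine in auto)

text \<open>The kept agents are all honest ones after an exchange: dropped honest agents out,
  Byzantine agents in. The index set \<open>H\<close> does not depend on the selection, so only the
  exchange has to be controlled through the filter.\<close>

lemma sum_split_filter:
  fixes g :: "nat \<Rightarrow> 'v::ab_group_add"
  assumes "\<omega> \<in> space M"
  shows "(\<Sum>i\<in>F k \<omega>. g i) = (\<Sum>i\<in>H. g i) + (\<Sum>i\<in>F k \<omega> - H. g i) - (\<Sum>i\<in>H - F k \<omega>. g i)"
proof -
  have "(\<Sum>i\<in>F k \<omega>. g i) = (\<Sum>i\<in>F k \<omega> - H. g i) + (\<Sum>i\<in>F k \<omega> \<inter> H. g i)"
    using sum.Int_Diff[of "F k \<omega>" g H] finite_filter[OF assms] by (simp add: add.commute)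
  moreover have "(\<Sum>i\<in>H. g i) = (\<Sum>i\<in>H - F k \<omega>. g i) + (\<Sum>i\<in>F k \<omega> \<inter> H. g i)"
    using sum.Int_Diff[of H g "F k \<omega>"] finite_H by (simp add: add.commute Int_commute)
  ultimately show ?thesis by simp
qed

end

section \<open>Gradients at the minimizer, displacements and the server step\<close>

locale strongly_convex_sgd = byzantine_local_sgd +
  fixes \<mu> :: real and xs
  assumes mu: "0 < \<mu>" "\<mu> \<le> L"
    and strongly_convex: "\<And>u v. (v - u) \<bullet> (grad (avg_cost H q) v - grad (avg_cost H q) u)
           \<ge> \<mu> * (norm (v - u))\<^sup>2"
    and minimizer: "minimizers (avg_cost H q) = {xs}"
begin

abbreviation sq_dist where
  "sq_dist k \<omega> \<equiv> (norm (xbar k \<omega> - xs))\<^sup>2"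

text \<open>With no honest agent the average cost would be constantly zero and every point a
  minimizer, contradicting uniqueness of \<open>xs\<close>.\<close>

lemma card_H_pos: "card H > 0"
proof (rule ccontr)
  assume "\<not> card H > 0"
  then have "minimizers (avg_cost H q) = UNIV"
    by (simp add: avg_cost_def minimizers_def is_arg_min_def)
  then have "xs + axis undefined 1 = xs" using minimizer by blast
  then show False by (simp add: axis_eq_0_iff)
qed

lemma N_eq: "real N = real (card H) + real f"
  using honest_card by (metis of_nat_add)

text \<open>If \<open>f > 0\<close>, removing a single agent \<open>i\<close> from \<open>H\<close>
  still respects the size bound of redundancy, which for \<open>H - {i}\<close> amounts to
  \<open>f \<ge> 1\<close>. The gradients at \<open>xs\<close> then sum to zero both over
  \<open>H\<close> and over \<open>H - {i}\<close>, and subtraction isolates agent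
  \<open>i\<close>.\<close>

lemma grad_minimizer_eq_0:
  assumes i: "i \<in> H"
  shows "grad (q i) xs = 0"
proof (cases "f = 0")
  case True
  then have "xs \<in> minimizers (q i)" using common_minimizers minimizer i by blast
  then show ?thesis using GDERIV_minimizer GDERIV_grad differentiable i by blast
next
  case False
  have sum_grad: "(\<Sum>j\<in>S. grad (q j) xs) = 0" if S: "S \<subseteq> H" "N \<le> card S + 2 * f" for S
  proof -
    have "minimizers (\<lambda>x. \<Sum>j\<in>S. q j x) = minimizers (\<lambda>x. \<Sum>j\<in>H. q j x)"
      using redundancy S unfolding two_f_redundant_def by blast
    also have "\<dots> = {xs}"
      using minimizer card_H_pos minimizers_scale[of "1 / real (card H)" "\<lambda>x. \<Sum>j\<in>H. q j x"]
      by (simp add: avg_cost_def[abs_def])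
    finally have "xs \<in> minimizers (\<lambda>x. \<Sum>j\<in>S. q j x)" by simp
    moreover have "GDERIV (\<lambda>x. \<Sum>j\<in>S. q j x) xs :> (\<Sum>j\<in>S. grad (q j) xs)"
      using S by (intro GDERIV_sum GDERIV_grad differentiable) auto
    ultimately show ?thesis by (rule GDERIV_minimizer)
  qed
  have "(\<Sum>j\<in>H. grad (q j) xs) = 0" "(\<Sum>j\<in>H - {i}. grad (q j) xs) = 0"
    using honest_card False i by (auto intro!: sum_grad simp: card_Diff_singleton)
  then show ?thesis using sum.remove[OF finite_H i, of "\<lambda>j. grad (q j) xs"] by simp
qed

lemma norm_grad_le: "i \<in> H \<Longrightarrow> norm (grad (q i) v) \<le> L * norm (v - xs)"
  using smooth[of i v xs] grad_minimizer_eq_0[of i] by simp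

lemma norm_direction_le:
  assumes "i \<in> H"
  shows "norm (y i k t \<omega>) \<le> norm (err i k t \<omega>) + L * norm (xbar k \<omega> - xs)"
proof -
  have "y i k t \<omega> = err i k t \<omega> + grad (q i) (xbar k \<omega>)" by (simp add: grad_error_def)
  then show ?thesis
    using norm_triangle_ineq[of "err i k t \<omega>" "grad (q i) (xbar k \<omega>)"]
      norm_grad_le[OF assms, of "xbar k \<omega>"] by simp
qed

lemma norm_direction_power2_le:
  assumes "i \<in> H"
  shows "(norm (y i k t \<omega>))\<^sup>2 \<le> 2 * ((norm (err i k t \<omega>))\<^sup>2 + L\<^sup>2 * sq_dist k \<omega>)"
proof -
  have "y i k t \<omega> = err i k t \<omega> + grad (q i) (xbar k \<omega>)" by (simp add: grad_error_def)
  moreover have "(norm (grad (q i) (xbar k \<omega>)))\<^sup>2 \<le> (L * norm (xbar k \<omega> - xs))\<^sup>2"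
    using norm_grad_le[OF assms] by (intro power_mono) auto
  ultimately show ?thesis
    using norm_add_power2_le[of "err i k t \<omega>" "grad (q i) (xbar k \<omega>)"]
    by (simp add: power_mult_distrib)
qed

lemma local_displacement_power2_le:
  assumes "i \<in> H" "\<omega> \<in> space M" "t \<le> T"
  shows "(norm (x i k t \<omega> - xbar k \<omega>))\<^sup>2
    \<le> 2 * (\<beta> k)\<^sup>2 * real T * ((\<Sum>s<t. (norm (err i k s \<omega>))\<^sup>2) + real T * L\<^sup>2 * sq_dist k \<omega>)"
proof -
  have "(norm (x i k t \<omega> - xbar k \<omega>))\<^sup>2 = (\<beta> k)\<^sup>2 * (norm (\<Sum>s<t. y i k s \<omega>))\<^sup>2"
    using local_displacement[OF assms] by (simp add: power_mult_distrib)
  also have "\<dots> \<le> (\<beta> k)\<^sup>2 * (real t * (\<Sum>s<t. (norm (y i k s \<omega>))\<^sup>2))"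
    by (intro mult_left_mono norm_sum_power2_le) auto
  also have "\<dots> \<le> (\<beta> k)\<^sup>2 * (real T *
      (\<Sum>s<t. 2 * ((norm (err i k s \<omega>))\<^sup>2 + L\<^sup>2 * sq_dist k \<omega>)))"
    using assms by (intro mult_left_mono mult_mono sum_mono norm_direction_power2_le sum_nonneg) auto
  also have "\<dots> = 2 * (\<beta> k)\<^sup>2 * real T *
      ((\<Sum>s<t. (norm (err i k s \<omega>))\<^sup>2) + real t * (L\<^sup>2 * sq_dist k \<omega>))"
    by (simp add: sum.distrib sum_distrib_left[symmetric])
  also have "\<dots> \<le> 2 * (\<beta> k)\<^sup>2 * real T *
      ((\<Sum>s<t. (norm (err i k s \<omega>))\<^sup>2) + real T * (L\<^sup>2 * sq_dist k \<omega>))"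
    using assms by (intro mult_left_mono add_left_mono mult_right_mono) auto
  finally show ?thesis by (simp add: mult.assoc)
qed

lemma sum_mean_sq_err:
  "(\<Sum>t\<in>A. mean_sq_err k t \<omega>)
     = (1 / real (card H)) * (\<Sum>i\<in>H. \<Sum>t\<in>A. (norm (err i k t \<omega>))\<^sup>2)"
  unfolding mean_sq_err_def sum_distrib_left[symmetric] by (subst sum.swap) (rule refl)

text \<open>The iterate at step \<open>t\<close> has moved only along the directions of steps
  \<open>s < t\<close>, so only earlier errors occur. Their sum becomes the memory term of the error
  recursion.\<close>

lemma mean_displacement_power2_le:
  assumes "\<omega> \<in> space M" "t \<le> T"
  shows "(1 / real (card H)) * (\<Sum>i\<in>H. (norm (x i k t \<omega> - xbar k \<omega>))\<^sup>2)
    \<le> 2 * (\<beta> k)\<^sup>2 * real T * ((\<Sum>s<t. mean_sq_err k s \<omega>) + real T * L\<^sup>2 * sq_dist k \<omega>)"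
proof -
  have "(\<Sum>i\<in>H. (norm (x i k t \<omega> - xbar k \<omega>))\<^sup>2) \<le> (\<Sum>i\<in>H. 2 * (\<beta> k)\<^sup>2 * real T *
     ((\<Sum>s<t. (norm (err i k s \<omega>))\<^sup>2) + real T * L\<^sup>2 * sq_dist k \<omega>))"
    using assms by (intro sum_mono local_displacement_power2_le)
  also have "\<dots> = real (card H) * (2 * (\<beta> k)\<^sup>2 * real T *
     ((\<Sum>s<t. mean_sq_err k s \<omega>) + real T * L\<^sup>2 * sq_dist k \<omega>))"
    using card_H_pos
    by (simp add: sum_mean_sq_err sum.distrib sum_distrib_left[symmetric] field_simps)
  finally show ?thesis using card_H_pos by (simp add: field_simps)
qed

text \<open>Exactly \<open>card H\<close> messages are averaged, so \<open>xbar k\<close> can be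
  subtracted inside the sum.\<close>

lemma server_step:
  assumes "\<omega> \<in> space M"
  shows "xbar (Suc k) \<omega> - xbar k \<omega>
    = (1 / real (card H)) *\<^sub>R (\<Sum>i\<in>F k \<omega>. x i k T \<omega> - xbar k \<omega>)"
  using card_H_pos filter_card_H[OF assms, of k]
  by (simp add: server[OF assms] sum_subtractf sum_constant_scaleR scaleR_diff_right
      del: sum_constant)

text \<open>The filter keeps as many agents as there are honest ones and only the closest, so
  Byzantine messages cannot lengthen the server step beyond the mean honest displacement.\<close>

lemma norm_server_step_power2_le:
  assumes \<omega>: "\<omega> \<in> space M"
  shows "(norm (xbar (Suc k) \<omega> - xbar k \<omega>))\<^sup>2
    \<le> (1 / real (card H)) * (\<Sum>i\<in>H. (norm (x i k T \<omega> - xbar k \<omega>))\<^sup>2)"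
proof -
  let ?g = "\<lambda>i. norm (x i k T \<omega> - xbar k \<omega>)" and ?n = "real (card H)"
  have "norm (\<Sum>i\<in>F k \<omega>. x i k T \<omega> - xbar k \<omega>) \<le> (\<Sum>i\<in>F k \<omega>. ?g i)" by (rule norm_sum)
  also have "\<dots> \<le> (\<Sum>i\<in>H. ?g i)"
    using sum_split_filter[OF \<omega>, of ?g k] sum_kept_byzantine_le[OF \<omega>, of k] by simp
  finally have "norm (xbar (Suc k) \<omega> - xbar k \<omega>) \<le> (1 / ?n) * (\<Sum>i\<in>H. ?g i)"
    using card_H_pos by (simp add: server_step[OF \<omega>] divide_right_mono)
  then have "(norm (xbar (Suc k) \<omega> - xbar k \<omega>))\<^sup>2 \<le> ((1 / ?n) * (\<Sum>i\<in>H. ?g i))\<^sup>2"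
    by (intro power_mono) auto
  also have "\<dots> \<le> (1 / ?n)\<^sup>2 * ((\<Sum>i\<in>H. (?g i)\<^sup>2) * ?n)"
    unfolding power_mult_distrib
    by (intro mult_left_mono sum_squared_le_sum_of_squares) auto
  also have "\<dots> = (1 / ?n) * (\<Sum>i\<in>H. (?g i)\<^sup>2)"
    using card_H_pos by (simp add: power2_eq_square)
  finally show ?thesis .
qed

lemma server_step_power2_le:
  assumes "\<omega> \<in> space M"
  shows "(norm (xbar (Suc k) \<omega> - xbar k \<omega>))\<^sup>2
    \<le> 2 * (\<beta> k)\<^sup>2 * real T * ((\<Sum>t<T. mean_sq_err k t \<omega>) + real T * L\<^sup>2 * sq_dist k \<omega>)"
  using norm_server_step_power2_le[OF assms] mean_displacement_power2_le[OF assms order_refl]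
  by (rule order_trans)

text \<open>The weight \<open>\<eta>\<close> is left free. It will be
  \<open>\<alpha> k * real T / 4\<close>, small enough for \<open>1 + \<eta>\<close> to cost only a
  quarter of the contraction gained in the round.\<close>

lemma mean_sq_err_next_round_le:
  assumes \<omega>: "\<omega> \<in> space M" and "\<eta> > 0"
  shows "mean_sq_err (Suc k) 0 \<omega> \<le> (1 + \<eta>) * mean_sq_err k T \<omega>
    + (1 + 1 / \<eta>) * L\<^sup>2 * (norm (xbar (Suc k) \<omega> - xbar k \<omega>))\<^sup>2"
proof -
  let ?d = "(norm (xbar (Suc k) \<omega> - xbar k \<omega>))\<^sup>2" and ?n = "real (card H)"
  have "(norm (err i k T \<omega> + (grad (q i) (xbar k \<omega>) - grad (q i) (xbar (Suc k) \<omega>))))\<^sup>2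
      \<le> (1 + \<eta>) * (norm (err i k T \<omega>))\<^sup>2 + (1 + 1 / \<eta>) * (L\<^sup>2 * ?d)" if "i \<in> H" for i
  proof -
    have "(norm (grad (q i) (xbar k \<omega>) - grad (q i) (xbar (Suc k) \<omega>)))\<^sup>2 \<le> L\<^sup>2 * ?d"
      using power_mono[OF smooth[OF that, of "xbar k \<omega>" "xbar (Suc k) \<omega>"], of 2]
      by (simp add: power_mult_distrib norm_minus_commute)
    then have "(1 + 1 / \<eta>) * (norm (grad (q i) (xbar k \<omega>) - grad (q i) (xbar (Suc k) \<omega>)))\<^sup>2
        \<le> (1 + 1 / \<eta>) * (L\<^sup>2 * ?d)"
      using \<open>\<eta> > 0\<close> by (intro mult_left_mono) auto
    then show ?thesis
      using norm_add_power2_young[OF \<open>\<eta> > 0\<close>, of "err i k T \<omega>"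
          "grad (q i) (xbar k \<omega>) - grad (q i) (xbar (Suc k) \<omega>)"] by linarith
  qed
  then have "mean_sq_err (Suc k) 0 \<omega> \<le> (1 / ?n) *
      (\<Sum>i\<in>H. (1 + \<eta>) * (norm (err i k T \<omega>))\<^sup>2 + (1 + 1 / \<eta>) * (L\<^sup>2 * ?d))"
    unfolding mean_sq_err_Suc_0[OF \<omega>] by (intro mult_left_mono sum_mono) auto
  also have "\<dots> = (1 + \<eta>) * mean_sq_err k T \<omega> + (1 + 1 / \<eta>) * L\<^sup>2 * ?d"
    using card_H_pos
    by (simp add: sum.distrib sum_distrib_left[symmetric] mean_sq_err_def field_simps)
  finally show ?thesis .
qed

section \<open>Decrease of the distance to the minimizer\<close>

lemma avg_inner_grad_ge:
  "(v - xs) \<bullet> ((1 / real (card H)) *\<^sub>R (\<Sum>i\<in>H. grad (q i) v)) \<ge> \<mu> * (norm (v - xs))\<^sup>2"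
  using strongly_convex[of v xs] differentiable
  by (simp add: grad_avg_cost grad_minimizer_eq_0)

text \<open>Substituting \<open>y = grad + err\<close> into the honest part of the server step isolates a
  gradient step of length \<open>T \<beta>\<close>.\<close>

lemma inner_honest_step_le:
  assumes \<omega>: "\<omega> \<in> space M"
  shows "2 * ((xbar k \<omega> - xs) \<bullet> ((1 / real (card H)) *\<^sub>R (\<Sum>i\<in>H. x i k T \<omega> - xbar k \<omega>)))
    \<le> (- 2 * \<mu> + \<mu> / 24) * real T * \<beta> k * sq_dist k \<omega>
      + 24 * \<beta> k / \<mu> * (\<Sum>t<T. mean_sq_err k t \<omega>)"
proof -
  let ?e = "xbar k \<omega> - xs" and ?n = "real (card H)"
  have split: "x i k T \<omega> - xbar k \<omega>
      = - (real T * \<beta> k) *\<^sub>R grad (q i) (xbar k \<omega>) - \<beta> k *\<^sub>R (\<Sum>t<T. err i k t \<omega>)" if "i \<in> H" for i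
    using local_displacement[OF that \<omega> order_refl, of k]
    by (simp add: grad_error_def sum_subtractf sum_constant_scaleR algebra_simps del: sum_constant)
  have "(\<Sum>i\<in>H. x i k T \<omega> - xbar k \<omega>)
      = - (real T * \<beta> k) *\<^sub>R (\<Sum>i\<in>H. grad (q i) (xbar k \<omega>)) - \<beta> k *\<^sub>R (\<Sum>i\<in>H. \<Sum>t<T. err i k t \<omega>)"
    by (simp add: split sum_subtractf scaleR_sum_right sum_negf)
  moreover have "(\<Sum>i\<in>H. \<Sum>t<T. - 2 * (?e \<bullet> err i k t \<omega>)) = - 2 * (?e \<bullet> (\<Sum>i\<in>H. \<Sum>t<T. err i k t \<omega>))"
    by (simp only: inner_sum_right sum_distrib_left)
  ultimately have eq: "2 * (?e \<bullet> ((1 / ?n) *\<^sub>R (\<Sum>i\<in>H. x i k T \<omega> - xbar k \<omega>)))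
      = - 2 * (real T * \<beta> k) * (?e \<bullet> ((1 / ?n) *\<^sub>R (\<Sum>i\<in>H. grad (q i) (xbar k \<omega>))))
        + \<beta> k / ?n * (\<Sum>i\<in>H. \<Sum>t<T. - 2 * (?e \<bullet> err i k t \<omega>))"
    by (simp only: inner_diff_right inner_scaleR_right) (simp add: algebra_simps diff_divide_distrib)
  \<comment> \<open>The weight \<open>\<mu> / 24\<close> is half of the gap between
    \<open>2 * \<mu>\<close> and the final \<open>23 / 12 * \<mu>\<close>; the other half stays
    available for the higher-order terms.\<close>
  have "- 2 * (?e \<bullet> err i k t \<omega>) \<le> \<mu> / 24 * sq_dist k \<omega> + 24 / \<mu> * (norm (err i k t \<omega>))\<^sup>2" for i t
  proof -
    have "- 2 * (?e \<bullet> err i k t \<omega>) \<le> 2 * norm ?e * norm (err i k t \<omega>)"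
      using Cauchy_Schwarz_ineq2[of ?e "err i k t \<omega>"] by (simp add: abs_le_iff)
    also have "\<dots> \<le> \<mu> / 24 * sq_dist k \<omega> + (norm (err i k t \<omega>))\<^sup>2 / (\<mu> / 24)"
      using mu by (intro mult_le_young) auto
    finally show ?thesis by (simp add: mult.commute)
  qed
  then have "\<beta> k / ?n * (\<Sum>i\<in>H. \<Sum>t<T. - 2 * (?e \<bullet> err i k t \<omega>))
      \<le> \<beta> k / ?n * (\<Sum>i\<in>H. \<Sum>t<T. \<mu> / 24 * sq_dist k \<omega> + 24 / \<mu> * (norm (err i k t \<omega>))\<^sup>2)"
    using beta_pos[of k] by (intro mult_left_mono sum_mono) auto
  also have "\<dots> = \<mu> / 24 * real T * \<beta> k * sq_dist k \<omega> + 24 * \<beta> k / \<mu> * (\<Sum>t<T. mean_sq_err k t \<omega>)"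
    using card_H_pos
    by (simp only: sum_mean_sq_err sum.distrib sum_distrib_left[symmetric] sum_constant)
      (simp add: algebra_simps add_divide_distrib)
  finally have err: "\<beta> k / ?n * (\<Sum>i\<in>H. \<Sum>t<T. - 2 * (?e \<bullet> err i k t \<omega>)) \<le> \<dots>" .
  have "real T * \<beta> k * (\<mu> * sq_dist k \<omega>)
      \<le> real T * \<beta> k * (?e \<bullet> ((1 / ?n) *\<^sub>R (\<Sum>i\<in>H. grad (q i) (xbar k \<omega>))))"
    using beta_pos[of k] avg_inner_grad_ge by (intro mult_left_mono) auto
  then show ?thesis unfolding eq using err by (simp add: algebra_simps)
qed

text \<open>The exchange made by the filter is at most twice the total displacement of the dropped
  honest agents, so no bound on the Byzantine vectors themselves enters. The number of kept
  Byzantine agents, equal to that of the dropped honest ones, survives only as a factor of the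
  squared distance.\<close>

lemma inner_byzantine_step_le:
  assumes \<omega>: "\<omega> \<in> space M"
  shows "2 * ((xbar k \<omega> - xs) \<bullet> ((1 / real (card H)) *\<^sub>R
      ((\<Sum>i\<in>F k \<omega> - H. x i k T \<omega> - xbar k \<omega>) - (\<Sum>i\<in>H - F k \<omega>. x i k T \<omega> - xbar k \<omega>))))
    \<le> 17 * L * real T * \<beta> k * real (card (F k \<omega> - H)) / (3 * real (card H)) * sq_dist k \<omega>
      + 12 * \<beta> k / (5 * L) * (\<Sum>t<T. mean_sq_err k t \<omega>)"
    (is "2 * (?e \<bullet> ((1 / ?n) *\<^sub>R ?E)) \<le> _")
proof -
  let ?g = "\<lambda>i. norm (x i k T \<omega> - xbar k \<omega>)" and ?J = "H - F k \<omega>"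
  have "norm ?E \<le> (\<Sum>i\<in>F k \<omega> - H. ?g i) + (\<Sum>i\<in>?J. ?g i)"
    by (intro norm_triangle_le_diff add_mono norm_sum)
  also have "\<dots> \<le> 2 * (\<Sum>i\<in>?J. ?g i)" using sum_kept_byzantine_le[OF \<omega>, of k] by simp
  finally have E: "norm ?E \<le> 2 * (\<Sum>i\<in>?J. ?g i)" .
  have "4 * norm ?e * ?g i
      \<le> \<beta> k * (\<Sum>t<T. 17 / 3 * L * sq_dist k \<omega> + 12 / (5 * L) * (norm (err i k t \<omega>))\<^sup>2)" if "i \<in> H" for i
  proof -
    have "?g i = \<beta> k * norm (\<Sum>t<T. y i k t \<omega>)"
      using local_displacement[OF that \<omega> order_refl, of k] beta_pos[of k] by simp
    also have "\<dots> \<le> \<beta> k * (\<Sum>t<T. norm (err i k t \<omega>) + L * norm ?e)"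
      using beta_pos[of k] that
      by (intro mult_left_mono order_trans[OF norm_sum] sum_mono norm_direction_le) auto
    finally have "4 * norm ?e * ?g i \<le> 4 * norm ?e * (\<beta> k * (\<Sum>t<T. norm (err i k t \<omega>) + L * norm ?e))"
      by (intro mult_left_mono) auto
    also have "\<dots> = \<beta> k * (\<Sum>t<T. 4 * norm ?e * (norm (err i k t \<omega>) + L * norm ?e))"
      by (simp add: sum_distrib_left mult.left_commute)
    also have "\<dots> \<le> \<beta> k * (\<Sum>t<T. 17 / 3 * L * sq_dist k \<omega> + 12 / (5 * L) * (norm (err i k t \<omega>))\<^sup>2)"
    proof (intro mult_left_mono sum_mono)
      fix t
      \<comment> \<open>Young with weight \<open>5 * L / 6\<close>, used twice, adds
        \<open>5 / 3 * L\<close> to the \<open>4 * L\<close> from the gradient part, which gives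
        \<open>17 / 3 * L\<close>; the errors receive \<open>2 * 6 / (5 * L)\<close>.\<close>
      have "2 * norm ?e * norm (err i k t \<omega>)
          \<le> (5 * L / 6) * sq_dist k \<omega> + (norm (err i k t \<omega>))\<^sup>2 / (5 * L / 6)"
        using L_pos by (intro mult_le_young) auto
      then show "4 * norm ?e * (norm (err i k t \<omega>) + L * norm ?e)
          \<le> 17 / 3 * L * sq_dist k \<omega> + 12 / (5 * L) * (norm (err i k t \<omega>))\<^sup>2"
        by (simp add: algebra_simps power2_eq_square)
    qed (use beta_pos[of k] in auto)
    finally show ?thesis .
  qed
  then have "(\<Sum>i\<in>?J. 4 * norm ?e * ?g i)
      \<le> (\<Sum>i\<in>?J. \<beta> k * (\<Sum>t<T. 17 / 3 * L * sq_dist k \<omega> + 12 / (5 * L) * (norm (err i k t \<omega>))\<^sup>2))"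
    by (intro sum_mono) auto
  also have "\<dots> = 17 / 3 * L * real T * \<beta> k * real (card ?J) * sq_dist k \<omega>
      + 12 * \<beta> k / (5 * L) * (\<Sum>i\<in>?J. \<Sum>t<T. (norm (err i k t \<omega>))\<^sup>2)"
    by (simp only: sum.distrib sum_distrib_left[symmetric] sum_constant) (simp add: algebra_simps)
  \<comment> \<open>On the error part the random set of dropped agents is enlarged to all of
    \<open>H\<close>, which leaves a quantity whose expectation is controlled.\<close>
  also have "\<dots> \<le> 17 / 3 * L * real T * \<beta> k * real (card ?J) * sq_dist k \<omega>
      + 12 * \<beta> k / (5 * L) * (\<Sum>i\<in>H. \<Sum>t<T. (norm (err i k t \<omega>))\<^sup>2)"
    using beta_pos[of k] L_pos finite_H
    by (intro add_left_mono mult_left_mono sum_mono2 sum_nonneg) auto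
  finally have sum: "(\<Sum>i\<in>?J. 4 * norm ?e * ?g i) \<le> \<dots>" .
  have "2 * (?e \<bullet> ((1 / ?n) *\<^sub>R ?E)) \<le> (1 / ?n) * (2 * (norm ?e * norm ?E))"
    using norm_cauchy_schwarz[of ?e ?E] by (simp add: divide_right_mono)
  also have "\<dots> \<le> (1 / ?n) * (2 * (norm ?e * (2 * (\<Sum>i\<in>?J. ?g i))))"
    using E by (intro mult_left_mono) auto
  also have "\<dots> = (1 / ?n) * (\<Sum>i\<in>?J. 4 * norm ?e * ?g i)"
    by (simp add: sum_distrib_left mult.assoc)
  also have "\<dots> \<le> (1 / ?n) * (17 / 3 * L * real T * \<beta> k * real (card ?J) * sq_dist k \<omega>
      + 12 * \<beta> k / (5 * L) * (\<Sum>i\<in>H. \<Sum>t<T. (norm (err i k t \<omega>))\<^sup>2))"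
    using sum by (intro mult_left_mono) auto
  finally show ?thesis
    using card_kept_byzantine[OF \<omega>, of k] card_H_pos
    by (simp add: sum_mean_sq_err field_simps)
qed

lemma sq_dist_next_round_le:
  assumes \<omega>: "\<omega> \<in> space M"
  shows "sq_dist (Suc k) \<omega> \<le> (1 + (- 2 * \<mu> + \<mu> / 24) * real T * \<beta> k
      + 17 * L * real T * \<beta> k * real (card (F k \<omega> - H)) / (3 * real (card H))) * sq_dist k \<omega>
    + (24 * \<beta> k / \<mu> + 12 * \<beta> k / (5 * L)) * (\<Sum>t<T. mean_sq_err k t \<omega>)
    + (norm (xbar (Suc k) \<omega> - xbar k \<omega>))\<^sup>2"
proof -
  let ?e = "xbar k \<omega> - xs" and ?n = "real (card H)" and ?d = "xbar (Suc k) \<omega> - xbar k \<omega>"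
  have "(norm (?e + ?d))\<^sup>2 = sq_dist k \<omega> + 2 * (?e \<bullet> ?d) + (norm ?d)\<^sup>2"
    unfolding power2_norm_eq_inner inner_add by (simp only: inner_commute[of ?d ?e])
  then have "sq_dist (Suc k) \<omega> = sq_dist k \<omega> + 2 * (?e \<bullet> ?d) + (norm ?d)\<^sup>2" by simp
  moreover have "?d = (1 / ?n) *\<^sub>R (\<Sum>i\<in>H. x i k T \<omega> - xbar k \<omega>) + (1 / ?n) *\<^sub>R
      ((\<Sum>i\<in>F k \<omega> - H. x i k T \<omega> - xbar k \<omega>) - (\<Sum>i\<in>H - F k \<omega>. x i k T \<omega> - xbar k \<omega>))"
    unfolding server_step[OF \<omega>] sum_split_filter[OF \<omega>]
    by (simp add: scaleR_add_right[symmetric] add_diff_eq del: scaleR_add_right)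
  ultimately show ?thesis
    using inner_honest_step_le[OF \<omega>, of k] inner_byzantine_step_le[OF \<omega>, of k]
    by (simp only: inner_add_right distrib_left distrib_right)
qed

end

section \<open>Square-integrable random vectors\<close>

text \<open>Measurability is a separate conjunct because integrability of the squared norm does not
  imply measurability of the vector itself.\<close>

definition sq_integrable :: "'w measure \<Rightarrow> ('w \<Rightarrow> 'v::euclidean_space) \<Rightarrow> bool" where
  "sq_integrable M X \<longleftrightarrow> X \<in> borel_measurable M \<and> integrable M (\<lambda>\<omega>. (norm (X \<omega>))\<^sup>2)"

lemma sq_integrable_measurable: "sq_integrable M X \<Longrightarrow> X \<in> borel_measurable M"
  by (simp add: sq_integrable_def)

lemma sq_integrable_integrable: "sq_integrable M X \<Longrightarrow> integrable M (\<lambda>\<omega>. (norm (X \<omega>))\<^sup>2)"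
  by (simp add: sq_integrable_def)

lemma sq_integrable_bound:
  assumes "X \<in> borel_measurable M" "integrable M g"
    and "\<And>\<omega>. \<omega> \<in> space M \<Longrightarrow> (norm (X \<omega>))\<^sup>2 \<le> g \<omega>"
  shows "sq_integrable M X"
  unfolding sq_integrable_def
proof (intro conjI assms(1) Bochner_Integration.integrable_bound[OF assms(2)] AE_I2)
  show "norm ((norm (X \<omega>))\<^sup>2) \<le> norm (g \<omega>)" if "\<omega> \<in> space M" for \<omega>
    using order_trans[OF assms(3)[OF that] abs_ge_self] by simp
qed (use assms(1) in simp)

lemma sq_integrable_cong:
  assumes "\<And>\<omega>. \<omega> \<in> space M \<Longrightarrow> X \<omega> = Y \<omega>"
  shows "sq_integrable M X \<longleftrightarrow> sq_integrable M Y"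
  unfolding sq_integrable_def using assms
  by (intro arg_cong2[where f="(\<and>)"] measurable_cong Bochner_Integration.integrable_cong) auto

lemma sq_integrable_add:
  assumes "sq_integrable M X" "sq_integrable M Y"
  shows "sq_integrable M (\<lambda>\<omega>. X \<omega> + Y \<omega>)"
proof (rule sq_integrable_bound)
  show "integrable M (\<lambda>\<omega>. 2 * (norm (X \<omega>))\<^sup>2 + 2 * (norm (Y \<omega>))\<^sup>2)"
    using assms by (auto simp: sq_integrable_def)
  show "(\<lambda>\<omega>. X \<omega> + Y \<omega>) \<in> borel_measurable M"
    using assms by (auto simp: sq_integrable_def)
qed (rule norm_add_power2_le)

lemma sq_integrable_scaleR:
  "sq_integrable M X \<Longrightarrow> sq_integrable M (\<lambda>\<omega>. c *\<^sub>R X \<omega>)"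
  by (auto simp: sq_integrable_def power_mult_distrib)

lemma sq_integrable_diff:
  assumes "sq_integrable M X" "sq_integrable M Y"
  shows "sq_integrable M (\<lambda>\<omega>. X \<omega> - Y \<omega>)"
  using sq_integrable_add[OF assms(1) sq_integrable_scaleR[OF assms(2), of "-1"]] by simp

lemma (in finite_measure) sq_integrable_const: "sq_integrable M (\<lambda>_. c)"
  by (simp add: sq_integrable_def)

lemma sq_integrable_lipschitz:
  assumes "finite_measure M" "sq_integrable M X" and g: "g \<in> borel_measurable borel"
    and lip: "\<And>v. norm (g v - g u) \<le> L * norm (v - u)"
  shows "sq_integrable M (\<lambda>\<omega>. g (X \<omega>))"
proof -
  interpret finite_measure M by fact
  \<comment> \<open>The Lipschitz condition controls only increments from the fixed point
    \<open>u\<close>; the constant \<open>g u\<close> is added back afterwards, using finiteness of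
    the measure.\<close>
  have "sq_integrable M (\<lambda>\<omega>. g (X \<omega>) - g u)"
  proof (rule sq_integrable_bound)
    show "integrable M (\<lambda>\<omega>. L\<^sup>2 * (norm (X \<omega> - u))\<^sup>2)"
      using sq_integrable_diff[OF assms(2) sq_integrable_const[of u]] by (simp add: sq_integrable_def)
    show "(\<lambda>\<omega>. g (X \<omega>) - g u) \<in> borel_measurable M"
      using assms(2) by (intro borel_measurable_diff measurable_compose[OF _ g]) (auto simp: sq_integrable_def)
    show "(norm (g (X \<omega>) - g u))\<^sup>2 \<le> L\<^sup>2 * (norm (X \<omega> - u))\<^sup>2" for \<omega>
      using power_mono[OF lip, where n = 2] by (simp add: power_mult_distrib)
  qed
  from sq_integrable_add[OF this sq_integrable_const[of "g u"]] show ?thesis by simp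
qed

lemma sq_integrable_inner:
  assumes "sq_integrable M X" "sq_integrable M Y"
  shows "integrable M (\<lambda>\<omega>. X \<omega> \<bullet> Y \<omega>)"
proof (rule Bochner_Integration.integrable_bound)
  show "integrable M (\<lambda>\<omega>. (norm (X \<omega>))\<^sup>2 + (norm (Y \<omega>))\<^sup>2)"
    using assms by (auto simp: sq_integrable_def)
  show "(\<lambda>\<omega>. X \<omega> \<bullet> Y \<omega>) \<in> borel_measurable M"
    using assms by (auto simp: sq_integrable_def)
  have "\<bar>X \<omega> \<bullet> Y \<omega>\<bar> \<le> (norm (X \<omega>))\<^sup>2 + (norm (Y \<omega>))\<^sup>2" for \<omega>
  proof -
    have "\<bar>X \<omega> \<bullet> Y \<omega>\<bar> \<le> norm (X \<omega>) * norm (Y \<omega>)" by (rule Cauchy_Schwarz_ineq2)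
    also have "\<dots> \<le> 2 * norm (X \<omega>) * norm (Y \<omega>)" by simp
    also have "\<dots> \<le> (norm (X \<omega>))\<^sup>2 + (norm (Y \<omega>))\<^sup>2" by (rule sum_squares_bound)
    finally show ?thesis .
  qed
  then show "AE \<omega> in M. norm (X \<omega> \<bullet> Y \<omega>) \<le> norm ((norm (X \<omega>))\<^sup>2 + (norm (Y \<omega>))\<^sup>2)" by simp
qed

lemma (in finite_measure) sq_integrable_imp_integrable:
  assumes "sq_integrable M X"
  shows "integrable M X"
proof (rule Bochner_Integration.integrable_bound)
  show "integrable M (\<lambda>\<omega>. 1 + (norm (X \<omega>))\<^sup>2)"
    using assms by (auto simp: sq_integrable_def)
  have "norm (X \<omega>) \<le> 1 + (norm (X \<omega>))\<^sup>2" for \<omega>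
    using sum_squares_bound[of 1 "norm (X \<omega>)"] norm_ge_zero[of "X \<omega>"] by (simp, linarith)
  then show "AE \<omega> in M. norm (X \<omega>) \<le> norm (1 + (norm (X \<omega>))\<^sup>2)" by simp
qed (use assms in \<open>auto simp: sq_integrable_def\<close>)

section \<open>Measurability of the iterates\<close>

context byzantine_local_sgd
begin

abbreviation hist where
  "hist k t \<equiv> history M Z N H T \<Delta> xbar x y F k t"

lemma sample_measurable:
  assumes "i \<in> H" "t < T"
  shows "\<Delta> i k t \<in> M \<rightarrow>\<^sub>M Z"
proof -
  have "(i, k, t) \<in> H \<times> UNIV \<times> {..<T}" using assms by auto
  then have "(case (i, k, t) of (i, k, t) \<Rightarrow> \<Delta> i k t) \<in> M \<rightarrow>\<^sub>M Z"
    using samples_indep unfolding indep_vars_def by blast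
  then show ?thesis by simp
qed

lemma grad_measurable:
  assumes "i \<in> H"
  shows "grad (q i) \<in> borel_measurable borel"
proof -
  have "L-lipschitz_on UNIV (grad (q i))"
    using smooth[OF assms] L_pos by (intro lipschitz_onI) (auto simp: dist_norm)
  then show ?thesis
    by (intro borel_measurable_continuous_onI lipschitz_on_continuous_on)
qed

lemma stochastic_grad_measurable:
  assumes "i \<in> H" "t < T" "X \<in> borel_measurable M"
  shows "(\<lambda>\<omega>. G i (X \<omega>) (\<Delta> i k t \<omega>)) \<in> borel_measurable M"
  using measurable_compose[OF measurable_Pair[OF assms(3) sample_measurable[OF assms(1,2)]]
      G_measurable[OF assms(1)], of k] by simp

lemma local_measurable:
  assumes "i \<in> H" "xbar k \<in> borel_measurable M" "y i k 0 \<in> borel_measurable M" "t \<le> T"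
  shows "x i k t \<in> borel_measurable M \<and> y i k t \<in> borel_measurable M"
  using assms(4)
proof (induction t)
  case 0
  have "x i k 0 \<in> borel_measurable M \<longleftrightarrow> xbar k \<in> borel_measurable M"
    using assms(1) by (intro measurable_cong) (simp add: start_x)
  then show ?case using assms by simp
next
  case (Suc t)
  then have IH: "x i k t \<in> borel_measurable M" "y i k t \<in> borel_measurable M" by auto
  have "x i k (Suc t) \<in> borel_measurable M
      \<longleftrightarrow> (\<lambda>\<omega>. x i k t \<omega> - \<beta> k *\<^sub>R y i k t \<omega>) \<in> borel_measurable M"
    using assms(1) Suc by (intro measurable_cong) (simp add: step_x)
  moreover have "y i k (Suc t) \<in> borel_measurable M
      \<longleftrightarrow> (\<lambda>\<omega>. (1 - \<alpha> k) *\<^sub>R y i k t \<omega> + \<alpha> k *\<^sub>R G i (x i k t \<omega>) (\<Delta> i k t \<omega>)) \<in> borel_measurable M"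
    using assms(1) Suc by (intro measurable_cong) (simp add: step_y)
  ultimately show ?case
    using IH stochastic_grad_measurable[OF assms(1) _ IH(1), of t k] Suc by simp
qed

lemma server_measurable:
  assumes "\<And>i. i < N \<Longrightarrow> x i k T \<in> borel_measurable M"
  shows "xbar (Suc k) \<in> borel_measurable M"
proof -
  \<comment> \<open>The sum over a random index set is rewritten as one over the fixed set
    \<open>{..<N}\<close> with indicators, each summand of which is measurable.\<close>
  have "xbar (Suc k) \<in> borel_measurable M \<longleftrightarrow> (\<lambda>\<omega>. (1 / real (N - f)) *\<^sub>R
      (\<Sum>i<N. if i \<in> F k \<omega> then x i k T \<omega> else 0)) \<in> borel_measurable M"
  proof (rule measurable_cong)
    fix \<omega> assume \<omega>: "\<omega> \<in> space M"
    have "(\<Sum>i\<in>F k \<omega>. x i k T \<omega>) = (\<Sum>i<N. if i \<in> F k \<omega> then x i k T \<omega> else 0)"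
      using filter_subset[OF \<omega>, of k] by (simp add: sum.If_cases Int_absorb1)
    then show "xbar (Suc k) \<omega> = (1 / real (N - f)) *\<^sub>R
      (\<Sum>i<N. if i \<in> F k \<omega> then x i k T \<omega> else 0)"
      using server[OF \<omega>] filter_card[OF \<omega>] by simp
  qed
  moreover have "Measurable.pred M (\<lambda>\<omega>. i \<in> F k \<omega>)" for i
    using measurable_compose[OF filter_measurable, of "\<lambda>A. i \<in> A" "count_space UNIV" k] by simp
  ultimately show ?thesis using assms by simp
qed

lemma round_measurable: "xbar k \<in> borel_measurable M \<and> (\<forall>i\<in>H. y i k 0 \<in> borel_measurable M)"
proof (induction k)
  case 0
  have "xbar 0 \<in> borel_measurable M \<longleftrightarrow> (\<lambda>_. x0) \<in> borel_measurable M"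
    by (intro measurable_cong init_xbar)
  moreover have "y i 0 0 \<in> borel_measurable M \<longleftrightarrow> (\<lambda>_. y0 i) \<in> borel_measurable M" if "i \<in> H" for i
    using that by (intro measurable_cong init_y)
  ultimately show ?case by simp
next
  case (Suc k)
  have "x i k T \<in> borel_measurable M" if "i < N" for i
    using that local_measurable[of i k T] byzantine_message[of i k] Suc by (cases "i \<in> H") auto
  moreover have "y i (Suc k) 0 \<in> borel_measurable M" if "i \<in> H" for i
  proof -
    have "y i (Suc k) 0 \<in> borel_measurable M \<longleftrightarrow> y i k T \<in> borel_measurable M"
      using that by (intro measurable_cong start_y)
    then show ?thesis using that local_measurable[of i k T] Suc by simp
  qed
  ultimately show ?case using server_measurable by blast
qed

lemma xbar_measurable: "xbar k \<in> borel_measurable M"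
  and x_measurable: "i \<in> H \<Longrightarrow> t \<le> T \<Longrightarrow> x i k t \<in> borel_measurable M"
  and y_measurable: "i \<in> H \<Longrightarrow> t \<le> T \<Longrightarrow> y i k t \<in> borel_measurable M"
  using round_measurable local_measurable by blast+

section \<open>The history as a generated \<sigma>-algebra\<close>

lemma events_subset: "X \<in> M \<rightarrow>\<^sub>M A \<Longrightarrow> Defs.events M X A \<subseteq> sets M"
  unfolding Defs.events_def by (auto intro: measurable_sets)

lemma filter_measurable_UNIV: "F k \<in> M \<rightarrow>\<^sub>M count_space UNIV"
  using measurable_compose[OF filter_measurable, of "\<lambda>A. A" "count_space UNIV" k] by simp

text \<open>Hides the long union of generators behind what later arguments use: they are events of
  \<open>M\<close>, and they include those of the current iterates.\<close>

lemma history_generated: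
  "\<exists>S. hist k t = sigma (space M) S \<and> S \<subseteq> sets M
    \<and> (t \<le> T \<longrightarrow> (\<forall>i\<in>H. Defs.events M (x i k t) borel \<subseteq> S \<and> Defs.events M (y i k t) borel \<subseteq> S))
    \<and> Defs.events M (xbar k) borel \<subseteq> S"
  unfolding history_def
proof (intro exI conjI, rule refl)
  have "Defs.events M (\<Delta> i l s) Z \<subseteq> sets M" if "i \<in> H" "s < T" for i l s
    using that by (intro events_subset sample_measurable)
  moreover have "Defs.events M (x i l s) borel \<union> Defs.events M (y i l s) borel \<subseteq> sets M"
    if "i \<in> H" "s \<le> T" for i l s
    using that by (intro Un_least events_subset x_measurable y_measurable)
  moreover have "Defs.events M (xbar l) borel \<subseteq> sets M" for l
    by (intro events_subset xbar_measurable)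
  moreover have "Defs.events M (x i l T) borel \<subseteq> sets M" if "i \<in> {..<N} - H" for i l
    using that by (intro events_subset byzantine_message)
  moreover have "Defs.events M (F l) (count_space UNIV) \<subseteq> sets M" for l
    by (intro events_subset filter_measurable_UNIV)
  ultimately show "(\<Union>i\<in>H. \<Union>(l, s)\<in>{(l, s). s < T \<and> (l < k \<or> l = k \<and> s < t)}. Defs.events M (\<Delta> i l s) Z)
    \<union> (\<Union>i\<in>H. \<Union>(l, s)\<in>{(l, s). s \<le> T \<and> (l < k \<or> l = k \<and> s \<le> t)}.
         Defs.events M (x i l s) borel \<union> Defs.events M (y i l s) borel)
    \<union> (\<Union>l\<in>{..k}. Defs.events M (xbar l) borel)
    \<union> (\<Union>i\<in>{..<N} - H. \<Union>l\<in>{..<k}. Defs.events M (x i l T) borel)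
    \<union> (\<Union>l\<in>{..<k}. Defs.events M (F l) (count_space UNIV)) \<subseteq> sets M"
    by (intro Un_least UN_least) (clarsimp | blast)+
qed (intro impI ballI conjI | fastforce)+

lemma subalgebra_history: "subalgebra M (hist k t)"
proof -
  obtain S where S: "hist k t = sigma (space M) S" "S \<subseteq> sets M"
    using history_generated by blast
  moreover have "S \<subseteq> Pow (space M)" using S(2) sets.space_closed by blast
  ultimately show ?thesis
    by (simp add: subalgebra_def space_measure_of_conv sets.sigma_sets_subset)
qed

lemma measurable_sigma_events:
  assumes "Defs.events M X borel \<subseteq> S" "S \<subseteq> sets M"
  shows "X \<in> borel_measurable (sigma (space M) S)"
proof -
  have "S \<subseteq> Pow (space M)" using assms(2) sets.space_closed by blast
  moreover have "X -` E \<inter> space M \<in> S" if "E \<in> sets borel" for E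
    using assms(1) that by (auto simp: Defs.events_def)
  ultimately show ?thesis
    by (auto simp: measurable_def space_measure_of_conv)
qed

lemma history_measurable:
  shows "xbar k \<in> borel_measurable (hist k t)"
    and "i \<in> H \<Longrightarrow> t \<le> T \<Longrightarrow> x i k t \<in> borel_measurable (hist k t)"
    and "i \<in> H \<Longrightarrow> t \<le> T \<Longrightarrow> y i k t \<in> borel_measurable (hist k t)"
  using history_generated[of k t] measurable_sigma_events by metis+

section \<open>The noise of a local step\<close>

text \<open>Square integrability is a conclusion here. The conditional variance is that of a
  nonnegative function, so it can be integrated before anything is known to be finite, and the bound
  \<open>\<sigma>\<^sup>2\<close> then yields finiteness.\<close>

lemma noise_sq_integrable:
  assumes i: "i \<in> H" and t: "t < T" and X: "X \<in> borel_measurable (hist k t)"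
  shows "sq_integrable M (\<lambda>\<omega>. G i (X \<omega>) (\<Delta> i k t \<omega>) - grad (q i) (X \<omega>))"
    and "(LINT \<omega>|M. (norm (G i (X \<omega>) (\<Delta> i k t \<omega>) - grad (q i) (X \<omega>)))\<^sup>2) \<le> \<sigma>\<^sup>2"
proof -
  let ?\<xi> = "\<lambda>\<omega>. G i (X \<omega>) (\<Delta> i k t \<omega>) - grad (q i) (X \<omega>)"
  interpret sub: finite_measure_subalgebra M "hist k t"
    by unfold_locales (rule subalgebra_history)
  have XM: "X \<in> borel_measurable M"
    using X subalgebra_history measurable_from_subalg by blast
  have meas: "?\<xi> \<in> borel_measurable M"
    using stochastic_grad_measurable[OF i t XM] measurable_compose[OF XM grad_measurable[OF i]] by simp
  have "(\<integral>\<^sup>+ \<omega>. ennreal ((norm (?\<xi> \<omega>))\<^sup>2) \<partial>M)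
      = (\<integral>\<^sup>+ \<omega>. nn_cond_exp M (hist k t) (\<lambda>\<omega>. ennreal ((norm (?\<xi> \<omega>))\<^sup>2)) \<omega> \<partial>M)"
    using sub.nn_cond_exp_intg[of "\<lambda>_. 1" "\<lambda>\<omega>. ennreal ((norm (?\<xi> \<omega>))\<^sup>2)"] meas by simp
  also have "\<dots> \<le> (\<integral>\<^sup>+ \<omega>. ennreal (\<sigma>\<^sup>2) \<partial>M)"
    using noise_variance[OF i t X] by (rule nn_integral_mono_AE)
  also have "\<dots> = ennreal (\<sigma>\<^sup>2)" by (simp add: emeasure_space_1)
  finally have bound: "(\<integral>\<^sup>+ \<omega>. ennreal ((norm (?\<xi> \<omega>))\<^sup>2) \<partial>M) \<le> ennreal (\<sigma>\<^sup>2)" .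
  have int: "integrable M (\<lambda>\<omega>. (norm (?\<xi> \<omega>))\<^sup>2)"
    using meas bound by (intro integrableI_nonneg) (auto intro: le_less_trans)
  then show "sq_integrable M ?\<xi>" using meas by (simp add: sq_integrable_def)
  show "(LINT \<omega>|M. (norm (?\<xi> \<omega>))\<^sup>2) \<le> \<sigma>\<^sup>2"
    using bound nn_integral_eq_integral[OF int] by simp
qed

text \<open>Unlocks \<open>noise_mean\<close>, which applies only to integrable sampled
  gradients.\<close>

lemma stochastic_grad_sq_integrable:
  assumes i: "i \<in> H" and t: "t < T" and X: "X \<in> borel_measurable (hist k t)" "sq_integrable M X"
  shows "sq_integrable M (\<lambda>\<omega>. G i (X \<omega>) (\<Delta> i k t \<omega>))"
proof -
  have "sq_integrable M (\<lambda>\<omega>. grad (q i) (X \<omega>))"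
    by (rule sq_integrable_lipschitz[OF _ X(2) grad_measurable[OF i] smooth[OF i]]) unfold_locales
  from sq_integrable_add[OF noise_sq_integrable(1)[OF i t X(1)] this] show ?thesis by simp
qed

lemma measurable_vec_nth: "(\<lambda>v::real ^ 'n. v $ j) \<in> borel_measurable borel"
  by (intro borel_measurable_continuous_onI continuous_intros)

text \<open>Conditional expectations are componentwise, so the inner product is split into
  components. Each component of \<open>U\<close> is known to the history and can be moved through
  the conditional expectation; square integrability of both factors makes the products
  integrable.\<close>

lemma noise_orthogonal:
  assumes i: "i \<in> H" and t: "t < T" and X: "X \<in> borel_measurable (hist k t)" "sq_integrable M X"
    and U: "U \<in> borel_measurable (hist k t)" "sq_integrable M U"
  shows "(LINT \<omega>|M. U \<omega> \<bullet> (G i (X \<omega>) (\<Delta> i k t \<omega>) - grad (q i) (X \<omega>))) = 0"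
proof -
  let ?g = "\<lambda>\<omega>. G i (X \<omega>) (\<Delta> i k t \<omega>)" and ?r = "\<lambda>\<omega>. grad (q i) (X \<omega>)"
  interpret sub: finite_measure_subalgebra M "hist k t"
    by unfold_locales (rule subalgebra_history)
  have g: "sq_integrable M ?g" by (rule stochastic_grad_sq_integrable[OF i t X])
  have r: "sq_integrable M ?r"
    by (rule sq_integrable_lipschitz[OF _ X(2) grad_measurable[OF i] smooth[OF i]]) unfold_locales
  have comp: "sq_integrable M (\<lambda>\<omega>. Y \<omega> $ j)" if "sq_integrable M Y" for Y :: "'w \<Rightarrow> real ^ 'd" and j
  proof (rule sq_integrable_bound[OF _ sq_integrable_integrable[OF that]])
    show "(\<lambda>\<omega>. Y \<omega> $ j) \<in> borel_measurable M"
      using sq_integrable_measurable[OF that] measurable_vec_nth by (rule measurable_compose)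
    show "(norm (Y \<omega> $ j))\<^sup>2 \<le> (norm (Y \<omega>))\<^sup>2" for \<omega>
      using component_le_norm_cart[of "Y \<omega>" j] by (intro power_mono) auto
  qed
  have mean: "AE \<omega> in M. vec_cond_exp M (hist k t) ?g \<omega> = ?r \<omega>"
    by (rule noise_mean[OF i t X(1) sq_integrable_imp_integrable[OF g]])
  have int: "integrable M (\<lambda>\<omega>. U \<omega> $ j * Y \<omega> $ j)" if "sq_integrable M Y" for Y :: "'w \<Rightarrow> real ^ 'd" and j
    using sq_integrable_inner[OF comp[OF U(2), of j] comp[OF that, of j]] by (simp add: mult.commute)
  have "(LINT \<omega>|M. U \<omega> $ j * ?g \<omega> $ j) = (LINT \<omega>|M. U \<omega> $ j * ?r \<omega> $ j)" for j
  proof -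
    have "(LINT \<omega>|M. U \<omega> $ j * ?g \<omega> $ j)
        = (LINT \<omega>|M. U \<omega> $ j * real_cond_exp M (hist k t) (\<lambda>\<omega>. ?g \<omega> $ j) \<omega>)"
      using int[OF g, of j] measurable_compose[OF U(1) measurable_vec_nth]
        sq_integrable_measurable[OF comp[OF g, of j]]
      by (intro sub.real_cond_exp_intg(2)[symmetric]) auto
    also have "\<dots> = (LINT \<omega>|M. U \<omega> $ j * ?r \<omega> $ j)"
    proof (rule integral_cong_AE)
      show "AE \<omega> in M. U \<omega> $ j * real_cond_exp M (hist k t) (\<lambda>\<omega>. ?g \<omega> $ j) \<omega> = U \<omega> $ j * ?r \<omega> $ j"
        using mean by eventually_elim (simp add: vec_cond_exp_def vec_eq_iff)
      show "(\<lambda>\<omega>. U \<omega> $ j * ?r \<omega> $ j) \<in> borel_measurable M" using int[OF r] by auto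
      show "(\<lambda>\<omega>. U \<omega> $ j * real_cond_exp M (hist k t) (\<lambda>\<omega>. ?g \<omega> $ j) \<omega>) \<in> borel_measurable M"
        using sq_integrable_measurable[OF comp[OF U(2)]] by simp
    qed
    finally show ?thesis .
  qed
  then have "(LINT \<omega>|M. U \<omega> \<bullet> ?g \<omega>) = (LINT \<omega>|M. U \<omega> \<bullet> ?r \<omega>)"
    unfolding inner_vec_def inner_real_def using int[OF g] int[OF r] by (simp add: Bochner_Integration.integral_sum)
  then show ?thesis
    using sq_integrable_inner[OF U(2) g] sq_integrable_inner[OF U(2) r]
    by (simp add: inner_diff_right)
qed

end

section \<open>Real inequalities\<close>

text \<open>With \<open>z = a * real n\<close> the power is at most \<open>exp (- z)\<close>, hence
  at most \<open>1 / (1 + z)\<close>, and \<open>(1 - z + z\<^sup>2) * (1 + z) = 1 + z ^ 3\<close>.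
  This makes the contraction of a whole round comparable with quantities linear in its
  length.\<close>

lemma power_one_minus_le:
  fixes a :: real
  assumes "0 \<le> a" "a \<le> 1"
  shows "(1 - a) ^ n \<le> 1 - a * real n + (a * real n)\<^sup>2"
proof -
  define z where "z = a * real n"
  have "z \<ge> 0" using assms by (simp add: z_def)
  have "(1 - a) ^ n \<le> exp (- a) ^ n"
    using assms exp_ge_add_one_self[of "- a"] by (intro power_mono) auto
  also have "\<dots> = 1 / exp z"
    by (simp add: z_def exp_of_nat_mult[symmetric] inverse_eq_divide[symmetric] exp_minus[symmetric] mult.commute)
  also have "\<dots> \<le> 1 / (1 + z)"
    using \<open>z \<ge> 0\<close> exp_ge_add_one_self[of z] by (intro divide_left_mono) auto
  also have "\<dots> \<le> 1 - z + z\<^sup>2"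
  proof -
    have "(1 - z + z\<^sup>2) * (1 + z) = 1 + z ^ 3" by (simp add: power2_eq_square power3_eq_cube algebra_simps)
    then show ?thesis using \<open>z \<ge> 0\<close> by (simp add: divide_le_eq)
  qed
  finally show ?thesis by (simp add: z_def)
qed

text \<open>Scalar form of one round: \<open>a t\<close> stands for the expected mean squared error,
  \<open>w\<close> for \<open>L\<^sup>2\<close> times the expected squared distance,
  \<open>v\<close> for the noise, and \<open>p\<close> weighs the memory of earlier errors. A crude
  uniform bound is obtained first; reinserting it into the memory recovers the contraction.\<close>

lemma perturbed_contraction:
  fixes a :: "nat \<Rightarrow> real"
  assumes \<alpha>: "0 \<le> \<alpha>" "\<alpha> \<le> 1" and p: "0 \<le> p" "p * real T \<le> 1 / 2" and w: "0 \<le> w" and v: "0 \<le> v"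
    and a: "\<And>t. a t \<ge> 0"
    and step: "\<And>t. t < T \<Longrightarrow> a (Suc t) \<le> (1 - \<alpha>) * a t + \<alpha> * p * ((\<Sum>s<t. a s) + real T * w) + v"
  shows "\<And>t. t \<le> T \<Longrightarrow> a t \<le> a 0 + 2 * p * real T * w + real T * v"
    and "a T \<le> (1 - \<alpha> * real T + (\<alpha> * real T)\<^sup>2) * a 0
      + \<alpha> * real T * (p * real T) * (a 0 + 2 * p * real T * w + real T * v + w) + real T * v"
proof -
  let ?r = "\<lambda>t. a 0 + 2 * p * real T * w + real t * v"
  have r: "a t \<le> ?r t" if "t \<le> T" for t
    using that
  proof (induction t rule: less_induct)
    case (less t)
    show ?case
    proof (cases t)
      case 0
      then show ?thesis using p w by simp
    next
      case (Suc n)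
      have "(\<Sum>s<n. a s) \<le> (\<Sum>s<n. ?r n)"
      proof (rule sum_mono)
        fix s assume s: "s \<in> {..<n}"
        then have "a s \<le> ?r s" using less Suc by auto
        also have "\<dots> \<le> ?r n" using s v by (intro add_left_mono mult_right_mono) auto
        finally show "a s \<le> ?r n" .
      qed
      also have "\<dots> \<le> real T * ?r n"
        using less.prems Suc p w v a[of 0] by (simp, intro mult_right_mono) auto
      finally have "\<alpha> * p * ((\<Sum>s<n. a s) + real T * w) \<le> \<alpha> * p * (real T * ?r n + real T * w)"
        using \<alpha> p by (intro mult_left_mono) auto
      also have "\<dots> = \<alpha> * (p * real T) * ?r n + \<alpha> * p * real T * w" by (simp add: algebra_simps)
      also have "\<dots> \<le> \<alpha> * (1 / 2) * ?r n + \<alpha> * p * real T * w"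
        using \<alpha> p w v a[of 0] by (intro add_right_mono mult_right_mono mult_left_mono) auto
      finally have 1: "\<alpha> * p * ((\<Sum>s<n. a s) + real T * w) \<le> \<alpha> / 2 * ?r n + \<alpha> * p * real T * w"
        by simp
      have 2: "(1 - \<alpha>) * a n \<le> (1 - \<alpha>) * ?r n"
        using less Suc \<alpha> by (intro mult_left_mono) auto
      \<comment> \<open>By \<open>p * real T \<le> 1 / 2\<close> the memory uses half of the
        contraction. The other half covers the input \<open>\<alpha> * p * real T * w\<close>, which
        is why \<open>?r\<close> contains \<open>2 * p * real T * w\<close>.\<close>
      have "\<alpha> / 2 * (2 * p * real T * w) \<le> \<alpha> / 2 * ?r n"
        using \<alpha> a[of 0] v by (intro mult_left_mono) auto
      then have "a (Suc n) \<le> ?r n + v"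
        using step[of n] less.prems Suc 1 2 by (simp add: algebra_simps)
      then show ?thesis using Suc by (simp add: algebra_simps)
    qed
  qed
  show R: "a t \<le> ?r T" if "t \<le> T" for t
  proof -
    have "real t * v \<le> real T * v" using that v by (intro mult_right_mono) auto
    then show ?thesis using r[OF that] by linarith
  qed
  \<comment> \<open>Once the memory is replaced by the uniform bound, the recursion has constant
    input. Inputs are added up undamped; only the initial error is contracted.\<close>
  have "a t \<le> (1 - \<alpha>) ^ t * a 0 + real t * (\<alpha> * (p * real T) * (?r T + w) + v)" if "t \<le> T" for t
    using that
  proof (induction t)
    case (Suc t)
    let ?m = "\<alpha> * (p * real T) * (?r T + w) + v"
    have m: "?m \<ge> 0" using \<alpha> p w v a[of 0] by auto
    have "(\<Sum>s<t. a s) \<le> (\<Sum>s<t. ?r T)"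
      using Suc.prems by (intro sum_mono R) auto
    also have "\<dots> \<le> real T * ?r T"
      using Suc.prems p w v a[of 0] by (simp, intro mult_right_mono) auto
    finally have "\<alpha> * p * ((\<Sum>s<t. a s) + real T * w) \<le> \<alpha> * p * (real T * ?r T + real T * w)"
      using \<alpha> p by (intro mult_left_mono) auto
    then have "a (Suc t) \<le> (1 - \<alpha>) * a t + ?m"
      using step[of t] Suc.prems by (simp add: algebra_simps)
    also have "\<dots> \<le> (1 - \<alpha>) * ((1 - \<alpha>) ^ t * a 0 + real t * ?m) + ?m"
      using Suc \<alpha> by (intro add_right_mono mult_left_mono) auto
    also have "\<dots> \<le> (1 - \<alpha>) ^ Suc t * a 0 + real (Suc t) * ?m"
    proof -
      have "0 \<le> \<alpha> * (real t * ?m)" using \<alpha> m by simp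
      then show ?thesis by (simp add: left_diff_distrib distrib_left distrib_right mult.assoc)
    qed
    finally show ?case .
  qed simp
  from this[OF order_refl] have
    "a T \<le> (1 - \<alpha>) ^ T * a 0 + real T * (\<alpha> * (p * real T) * (?r T + w) + v)" .
  also have "\<dots> \<le> (1 - \<alpha> * real T + (\<alpha> * real T)\<^sup>2) * a 0
      + real T * (\<alpha> * (p * real T) * (?r T + w) + v)"
    using power_one_minus_le[OF \<alpha>, of T] a[of 0] by (intro add_right_mono mult_right_mono) auto
  finally show "a T \<le> (1 - \<alpha> * real T + (\<alpha> * real T)\<^sup>2) * a 0
      + \<alpha> * real T * (p * real T) * (?r T + w) + real T * v"
    by (simp add: algebra_simps)
qed

text \<open>Every term but \<open>- \<mu> / 24 * \<tau> \<beta> d\<close> and the contraction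
  of \<open>a\<^sub>0\<close> at rate \<open>\<alpha> \<tau>\<close> is of higher order: the ratio condition makes \<open>\<tau> \<beta>\<close>, even after
  multiplication by \<open>L^4\<close> or division by \<open>\<mu>\<close>, at most \<open>\<alpha> / 14^4\<close>.\<close>

lemma round_budget:
  fixes \<mu> L \<tau> \<alpha> \<beta> d a\<^sub>0 v A a\<^sub>T n :: real
  assumes mu: "0 < \<mu>" "\<mu> \<le> L" and \<tau>: "1 \<le> \<tau>" and pos: "0 < \<alpha>" "0 < \<beta>"
    and \<alpha>: "\<alpha> \<le> \<mu> / (8^4 * (L + 1)^4 * \<tau>)" and \<alpha>1: "\<alpha> \<le> 1"
    and ratio: "\<beta> / \<alpha> \<le> \<mu> / (14^4 * (L + 1)^4 * \<tau>)"
    and nonneg: "0 \<le> d" "0 \<le> a\<^sub>0" "0 \<le> v"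
    and p: "p = 2 * L\<^sup>2 * \<beta>\<^sup>2 * \<tau>"
    and R: "R = a\<^sub>0 + 2 * p * \<tau> * (L\<^sup>2 * d) + \<tau> * v"
    and A: "A \<le> \<tau> * R"
    and a\<^sub>T: "a\<^sub>T \<le> (1 - \<alpha> * \<tau> + (\<alpha> * \<tau>)\<^sup>2) * a\<^sub>0 + \<alpha> * \<tau> * (p * \<tau>) * (R + L\<^sup>2 * d) + \<tau> * v"
    and n: "n \<le> 2 * \<beta>\<^sup>2 * \<tau> * (A + \<tau> * L\<^sup>2 * d)"
  shows "- \<mu> / 24 * \<tau> * \<beta> * d + (24 * \<beta> / \<mu> + 12 * \<beta> / (5 * L)) * A + n
    + (1 + \<alpha> * \<tau> / 4) * a\<^sub>T + (1 + 1 / (\<alpha> * \<tau> / 4)) * L\<^sup>2 * n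
    - (1 - 23 / 12 * \<mu> * \<tau> * \<beta>) * a\<^sub>0 \<le> 2 * \<tau> * v"
    and "p * \<tau> \<le> 1 / 2"
proof -
  define \<epsilon> b z P :: real where "\<epsilon> = 1 / 14^4" and "b = \<beta> * \<tau>" and "z = \<alpha> * \<tau>" and "P = (L + 1)^4"
  have "L > 0" using mu by linarith
  have P: "P = L^4 + 4 * L^3 + 6 * L^2 + 4 * L + 1"
    by (simp add: P_def power2_eq_square power3_eq_cube power4_eq_xxxx algebra_simps)
  have powers: "0 < L^2" "0 < L^3" "0 < L^4" using \<open>L > 0\<close> by auto
  have "P \<ge> 1" using P powers \<open>L > 0\<close> by linarith
  have "\<mu> * \<mu> \<le> L\<^sup>2" unfolding power2_eq_square using mu by (intro mult_mono) auto
  then have "\<mu> * \<mu> \<le> P" using P powers \<open>L > 0\<close> by linarith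
  have "L\<^sup>2 * \<mu> \<le> L\<^sup>2 * L" using mu by (intro mult_left_mono) auto
  also have "\<dots> = L^3" by (simp add: power2_eq_square power3_eq_cube)
  finally have "L\<^sup>2 * \<mu> \<le> P" using P powers \<open>L > 0\<close> by linarith
  have "\<mu> \<le> P" "L\<^sup>2 \<le> P" "L^4 \<le> P" using P powers mu by linarith+
  have "0 < b" "0 < z" "\<alpha> \<le> z" "0 < \<epsilon>" using pos \<tau> by (auto simp: b_def z_def \<epsilon>_def)
  have "b * P \<le> \<epsilon> * \<alpha> * \<mu>"
    using ratio pos \<tau> \<open>L > 0\<close> by (simp add: field_simps b_def P_def \<epsilon>_def)
  then have bP: "b * u * P \<le> \<epsilon> * \<alpha> * (u * \<mu>)" if "u > 0" for u
    using mult_left_mono[of "b * P" "\<epsilon> * \<alpha> * \<mu>" u] that by (simp add: algebra_simps)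
  \<comment> \<open>Trades the factor \<open>(L + 1)^4\<close> of the ratio condition against any
    \<open>u\<close> with \<open>u * \<mu> \<le> c * P\<close>. The bounds below are instances, one
    for each power of \<open>L\<close> or \<open>\<mu>\<close> that occurs next to
    \<open>b\<close>.\<close>
  have cancel: "b * u \<le> \<epsilon> * \<alpha> * c" if "u * \<mu> \<le> c * P" "u > 0" for u c
  proof -
    have "\<epsilon> * \<alpha> * (u * \<mu>) \<le> \<epsilon> * \<alpha> * (c * P)"
      using that(1) \<open>0 < \<epsilon>\<close> pos by (intro mult_left_mono) auto
    then have "b * u * P \<le> \<epsilon> * \<alpha> * c * P"
      using bP[OF that(2)] by (simp add: mult.assoc)
    then show ?thesis using \<open>P \<ge> 1\<close> by simp
  qed
  have b1: "b \<le> \<epsilon> * \<alpha>" using cancel[of 1 1] \<open>\<mu> \<le> P\<close> by simp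
  have b\<mu>: "b * (1 / \<mu>) \<le> \<epsilon> * \<alpha>" using cancel[of "1 / \<mu>" 1] \<open>P \<ge> 1\<close> mu by simp
  have bmu: "b * \<mu> \<le> \<epsilon> * \<alpha>" using cancel[of \<mu> 1] \<open>\<mu> * \<mu> \<le> P\<close> mu by simp
  have bL2: "b * L\<^sup>2 \<le> \<epsilon> * \<alpha>" using cancel[of "L\<^sup>2" 1] \<open>L\<^sup>2 * \<mu> \<le> P\<close> powers by simp
  have bL2\<mu>: "b * L\<^sup>2 \<le> \<epsilon> * \<alpha> * \<mu>" using cancel[of "L\<^sup>2" \<mu>] \<open>L\<^sup>2 \<le> P\<close> powers mu by (simp add: mult.commute)
  have bL4: "b * L^4 \<le> \<epsilon> * \<alpha> * \<mu>" using cancel[of "L^4" \<mu>] \<open>L^4 \<le> P\<close> powers mu by (simp add: mult.commute)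
  have "z * P \<le> \<mu> / 4096"
    using \<alpha> \<tau> \<open>L > 0\<close> by (simp add: field_simps z_def P_def)
  then have "z * P \<le> 1 / 4096 * P" using \<open>\<mu> \<le> P\<close> by linarith
  then have z1: "z \<le> 1 / 4096" using \<open>P \<ge> 1\<close> by simp
  have b\<epsilon>: "b \<le> \<epsilon>" using b1 \<alpha>1 \<open>0 < \<epsilon>\<close> mult_left_le[of \<alpha> \<epsilon>] by linarith
  have bz: "b \<le> \<epsilon> * z" using b1 \<open>\<alpha> \<le> z\<close> \<open>0 < \<epsilon>\<close> mult_left_mono[of \<alpha> z \<epsilon>] by linarith
  define c where "c = p * \<tau>"
  have c: "c = 2 * b * (b * L\<^sup>2)" by (simp add: c_def p b_def power2_eq_square algebra_simps)
  have "2 * b * (b * L\<^sup>2) \<le> 2 * \<epsilon> * (\<epsilon> * \<alpha>)"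
    by (rule mult_mono) (use b\<epsilon> bL2 \<open>0 < b\<close> \<open>0 < \<epsilon>\<close> powers pos in auto)
  also have "\<dots> \<le> 2 * \<epsilon> * (\<epsilon> * 1)" using \<alpha>1 \<open>0 < \<epsilon>\<close> by (intro mult_left_mono) auto
  finally have c\<epsilon>: "c \<le> 2 * \<epsilon> * \<epsilon>" unfolding c by simp
  then show "p * \<tau> \<le> 1 / 2" by (simp add: c_def \<epsilon>_def)
  have "c \<le> \<epsilon>" using c\<epsilon> by (simp add: \<epsilon>_def)
  have "c \<ge> 0" using \<open>0 < b\<close> powers by (simp add: c)
  have "c * L\<^sup>2 = 2 * b * (b * L^4)" by (simp add: c power2_eq_square power4_eq_xxxx)
  also have "\<dots> \<le> 2 * b * (\<epsilon> * \<alpha> * \<mu>)" using bL4 \<open>0 < b\<close> by (intro mult_left_mono) auto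
  also have "\<dots> = 2 * \<epsilon> * (b * \<mu>) * \<alpha>" by simp
  also have "\<dots> \<le> 2 * \<epsilon> * (b * \<mu>) * 1" using \<alpha>1 \<open>0 < b\<close> \<open>0 < \<epsilon>\<close> mu by (intro mult_left_mono) auto
  finally have cL2: "c * L\<^sup>2 \<le> 2 * \<epsilon> * (b * \<mu>)" by simp
  have cL2d: "c * L\<^sup>2 * d \<le> 2 * \<epsilon> * (b * \<mu> * d)"
    using mult_right_mono[OF cL2 nonneg(1)] by (simp add: mult.assoc)
  have R': "R = a\<^sub>0 + 2 * (c * L\<^sup>2 * d) + \<tau> * v" by (simp add: R c_def algebra_simps)
  have "R \<ge> 0" using R' \<open>c \<ge> 0\<close> nonneg \<tau> by simp
  \<comment> \<open>Distance terms are measured in units of \<open>X\<close>; together they have to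
    fit into the reserve \<open>X / 24\<close>.\<close>
  define X where "X = b * \<mu> * d"
  have "X \<ge> 0" using \<open>0 < b\<close> mu nonneg by (simp add: X_def)
  have RX: "R \<le> a\<^sub>0 + 4 * \<epsilon> * X + \<tau> * v" using R' cL2d unfolding X_def by linarith

  have "(24 * \<beta> / \<mu> + 12 * \<beta> / (5 * L)) * A \<le> (24 * \<beta> / \<mu> + 12 * \<beta> / (5 * L)) * (\<tau> * R)"
    using A pos mu \<open>L > 0\<close> by (intro mult_left_mono) auto
  also have "\<dots> = (24 * (b / \<mu>) + 12 / 5 * (b / L)) * R" by (simp add: b_def algebra_simps)
  also have "\<dots> \<le> (24 * (\<epsilon> * z) + 12 / 5 * (\<epsilon> * z)) * R"
  proof -
    have "\<epsilon> * \<alpha> \<le> \<epsilon> * z" using \<open>\<alpha> \<le> z\<close> \<open>0 < \<epsilon>\<close> by simp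
    moreover have "b / L \<le> b / \<mu>" using mu \<open>0 < b\<close> by (intro divide_left_mono) auto
    ultimately have "b / \<mu> \<le> \<epsilon> * z" "b / L \<le> \<epsilon> * z" using b\<mu> by auto
    then show ?thesis using \<open>R \<ge> 0\<close> by (intro mult_right_mono add_mono) auto
  qed
  also have "\<dots> \<le> 27 * (\<epsilon> * z * R)" using \<open>0 < \<epsilon>\<close> \<open>0 < z\<close> \<open>R \<ge> 0\<close> by (simp add: algebra_simps)
  finally have 1: "(24 * \<beta> / \<mu> + 12 * \<beta> / (5 * L)) * A \<le> 27 * (\<epsilon> * z * R)" .

  have "n \<le> 2 * \<beta>\<^sup>2 * \<tau> * (\<tau> * R + \<tau> * L\<^sup>2 * d)"
    using A pos \<tau> by (intro order_trans[OF n] mult_left_mono add_right_mono) auto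
  also have "\<dots> = 2 * b * (b * (R + L\<^sup>2 * d))" by (simp add: b_def power2_eq_square algebra_simps)
  finally have n': "n \<le> 2 * b * (b * (R + L\<^sup>2 * d))" .
  have bL2d: "b * L\<^sup>2 * (b * d) \<le> \<epsilon> * X"
  proof -
    have "b * L\<^sup>2 * (b * d) \<le> \<epsilon> * \<alpha> * \<mu> * (b * d)"
      using bL2\<mu> \<open>0 < b\<close> nonneg by (intro mult_right_mono) auto
    also have "\<dots> = \<epsilon> * X * \<alpha>" by (simp add: X_def)
    also have "\<dots> \<le> \<epsilon> * X * 1" using \<alpha>1 \<open>X \<ge> 0\<close> \<open>0 < \<epsilon>\<close> by (intro mult_left_mono) auto
    finally show ?thesis by simp
  qed
  have "b * b \<le> \<epsilon> * (\<epsilon> * z)" by (rule mult_mono) (use b\<epsilon> bz \<open>0 < b\<close> \<open>0 < \<epsilon>\<close> in auto)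
  then have bbR: "b * b * R \<le> \<epsilon> * (\<epsilon> * z) * R" using \<open>R \<ge> 0\<close> by (rule mult_right_mono)
  have "n \<le> 2 * (b * b * R) + 2 * (b * L\<^sup>2 * (b * d))" using n' by (simp add: algebra_simps)
  also have "\<dots> \<le> 2 * \<epsilon> * (\<epsilon> * z * R) + 2 * \<epsilon> * X" using bbR bL2d by (simp add: mult.assoc)
  finally have 2: "n \<le> 2 * \<epsilon> * (\<epsilon> * z * R) + 2 * \<epsilon> * X" .

  \<comment> \<open>The change of reference gradient brings a division by the small
    \<open>z\<close>. It is cancelled by one of the two factors \<open>b\<close> in the squared
    server step, as \<open>b * L\<^sup>2\<close> and \<open>b * L^4\<close> are at most
    \<open>\<epsilon> * z\<close> and \<open>\<epsilon> * z * \<mu>\<close>.\<close>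
  have "(1 + 1 / (\<alpha> * \<tau> / 4)) * L\<^sup>2 \<le> 5 / z * L\<^sup>2"
    using z1 \<open>0 < z\<close> by (intro mult_right_mono) (auto simp: z_def[symmetric] field_simps)
  then have "(1 + 1 / (\<alpha> * \<tau> / 4)) * L\<^sup>2 * n \<le> 5 / z * L\<^sup>2 * (2 * b * (b * (R + L\<^sup>2 * d)))"
    using n' \<open>0 < z\<close> \<open>0 < b\<close> \<open>R \<ge> 0\<close> nonneg powers pos \<tau> 
    by (intro order_trans[OF mult_left_mono[OF n'] mult_right_mono]) auto
  also have "\<dots> = 10 / z * (b * L\<^sup>2 * (b * R) + b * L^4 * (b * d))"
    by (simp add: power2_eq_square power4_eq_xxxx field_simps)
  also have "\<dots> \<le> 10 / z * (\<epsilon> * z * (b * R) + \<epsilon> * z * \<mu> * (b * d))"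
  proof -
    have "\<epsilon> * \<alpha> \<le> \<epsilon> * z" "\<epsilon> * \<alpha> * \<mu> \<le> \<epsilon> * z * \<mu>" using \<open>\<alpha> \<le> z\<close> \<open>0 < \<epsilon>\<close> mu by auto
    then show ?thesis
      using bL2 bL4 \<open>0 < z\<close> \<open>0 < b\<close> \<open>R \<ge> 0\<close> nonneg
      by (intro mult_left_mono add_mono mult_right_mono) auto
  qed
  also have "\<dots> = 10 * \<epsilon> * (b * R) + 10 * \<epsilon> * X"
    using \<open>0 < z\<close> by (simp add: X_def field_simps)
  also have "\<dots> \<le> 10 * \<epsilon> * (\<epsilon> * z * R) + 10 * \<epsilon> * X"
    using bz \<open>0 < \<epsilon>\<close> \<open>R \<ge> 0\<close> by (intro add_right_mono mult_left_mono mult_right_mono) auto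
  finally have 3: "(1 + 1 / (\<alpha> * \<tau> / 4)) * L\<^sup>2 * n \<le> 10 * \<epsilon> * (\<epsilon> * z * R) + 10 * \<epsilon> * X" .

  have "z * c * (R + L\<^sup>2 * d) = z * R * c + z * (c * L\<^sup>2 * d)" by (simp add: algebra_simps)
  also have "\<dots> \<le> z * R * \<epsilon> + 1 * (2 * \<epsilon> * X)"
  proof (rule add_mono)
    show "z * R * c \<le> z * R * \<epsilon>"
      using \<open>c \<le> \<epsilon>\<close> \<open>0 < z\<close> \<open>R \<ge> 0\<close> by (intro mult_left_mono) auto
    show "z * (c * L\<^sup>2 * d) \<le> 1 * (2 * \<epsilon> * X)"
      by (rule mult_mono) (use z1 cL2d \<open>0 < z\<close> \<open>c \<ge> 0\<close> nonneg in \<open>auto simp: X_def\<close>)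
  qed
  finally have zc: "z * c * (R + L\<^sup>2 * d) \<le> \<epsilon> * z * R + 2 * \<epsilon> * X" by (simp add: algebra_simps)
  have "(1 + z / 4) * a\<^sub>T \<le> (1 + z / 4) * ((1 - z + z\<^sup>2) * a\<^sub>0 + (\<epsilon> * z * R + 2 * \<epsilon> * X) + \<tau> * v)"
    using a\<^sub>T zc \<open>0 < z\<close> unfolding c_def[symmetric] z_def[symmetric] by (intro mult_left_mono) auto
  also have "\<dots> = (1 + z / 4) * (1 - z + z\<^sup>2) * a\<^sub>0 + (1 + z / 4) * (\<epsilon> * z * R + 2 * \<epsilon> * X + \<tau> * v)"
    by (simp add: algebra_simps)
  \<comment> \<open>The factor \<open>1 + z / 4\<close> takes a quarter of the contraction, and the
    terms of order \<open>z\<^sup>2\<close> stay below another quarter because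
    \<open>z \<le> 1 / 4096\<close>.\<close>
  also have "\<dots> \<le> (1 - z / 2) * a\<^sub>0 + 5 / 4 * (\<epsilon> * z * R + 2 * \<epsilon> * X + \<tau> * v)"
  proof -
    have "z * z \<le> z * (1 / 4096)" "z * z * z \<le> z * z * 1"
      using z1 \<open>0 < z\<close> by (intro mult_left_mono; simp)+
    moreover have "(1 + z / 4) * (1 - z + z\<^sup>2) = 1 - 3 / 4 * z + 3 / 4 * (z * z) + z * z * z / 4"
      by (simp add: power2_eq_square field_simps)
    ultimately have "(1 + z / 4) * (1 - z + z\<^sup>2) \<le> 1 - z / 2"
      using \<open>0 < z\<close> by linarith
    moreover have "0 \<le> \<epsilon> * z * R + 2 * \<epsilon> * X + \<tau> * v"
      using \<open>0 < z\<close> \<open>0 < \<epsilon>\<close> \<open>R \<ge> 0\<close> \<open>X \<ge> 0\<close> \<tau> nonneg by simp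
    ultimately show ?thesis using z1 nonneg by (intro add_mono mult_right_mono) auto
  qed
  finally have 4: "(1 + z / 4) * a\<^sub>T \<le> (1 - z / 2) * a\<^sub>0 + 5 / 4 * (\<epsilon> * z * R + 2 * \<epsilon> * X + \<tau> * v)" .

  have "\<epsilon> * z * R \<le> \<epsilon> * z * (a\<^sub>0 + 4 * \<epsilon> * X + \<tau> * v)"
    using RX \<open>0 < z\<close> \<open>0 < \<epsilon>\<close> by (intro mult_left_mono) auto
  also have "\<dots> \<le> \<epsilon> * (z * a\<^sub>0) + \<epsilon> * X + \<epsilon> * (\<tau> * v)"
  proof -
    have "4 * \<epsilon> * X \<le> X" using \<open>X \<ge> 0\<close> by (simp add: \<epsilon>_def)
    then have "z * (4 * \<epsilon> * X) \<le> 1 * X"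
      by (rule mult_mono[rotated]) (use z1 \<open>0 < \<epsilon>\<close> \<open>X \<ge> 0\<close> in auto)
    moreover have "z * (\<tau> * v) \<le> 1 * (\<tau> * v)"
      using z1 \<tau> nonneg by (intro mult_right_mono) auto
    ultimately have "\<epsilon> * (z * (4 * \<epsilon> * X)) \<le> \<epsilon> * X" "\<epsilon> * (z * (\<tau> * v)) \<le> \<epsilon> * (\<tau> * v)"
      using \<open>0 < \<epsilon>\<close> by auto
    then show ?thesis by (simp add: algebra_simps)
  qed
  finally have Y: "\<epsilon> * z * R \<le> \<epsilon> * (z * a\<^sub>0) + \<epsilon> * X + \<epsilon> * (\<tau> * v)" .
  \<comment> \<open>The decrease required of the error part of the potential is tiny against its own
    contraction \<open>z / 2\<close>, so distance and errors can share one factor.\<close>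
  have "b * \<mu> \<le> \<epsilon> * z" using bmu \<open>\<alpha> \<le> z\<close> \<open>0 < \<epsilon>\<close> mult_left_mono[of \<alpha> z \<epsilon>] by linarith
  then have 5: "b * \<mu> * a\<^sub>0 \<le> \<epsilon> * (z * a\<^sub>0)" using nonneg mult_right_mono by fastforce
  define U Q where "U = z * a\<^sub>0" and "Q = \<epsilon> * z * R"
  have "Q \<ge> 0" "U \<ge> 0" using \<open>0 < z\<close> \<open>0 < \<epsilon>\<close> \<open>R \<ge> 0\<close> nonneg by (auto simp: Q_def U_def)
  have \<epsilon>: "\<epsilon> * u = u / 38416" for u by (simp add: \<epsilon>_def)
  \<comment> \<open>With products abstracted to variables only linear arithmetic remains;
    \<open>38416\<close> is \<open>14^4\<close>. The noise coefficient \<open>5 / 4\<close> grows by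
    multiples of \<open>1 / 38416\<close> and stays below \<open>2\<close>.\<close>
  have linear: "- X / 24 + k + n + t + s - (a\<^sub>0 - 23 / 12 * m) \<le> 2 * w"
    if "k \<le> 27 * Q" "n \<le> 2 * E + 2 * (X / 38416)" "s \<le> 10 * E + 10 * (X / 38416)"
      "t \<le> a\<^sub>0 - U / 2 + 5 / 4 * (Q + 2 * (X / 38416) + w)" "m \<le> U / 38416" "E \<le> Q"
      "Q \<le> U / 38416 + X / 38416 + w / 38416" "0 \<le> X" "0 \<le> U" "0 \<le> w"
    for k n t s m w E Q U X :: real
    using that by argo
  have "- X / 24 + (24 * \<beta> / \<mu> + 12 * \<beta> / (5 * L)) * A + n
    + (1 + z / 4) * a\<^sub>T + (1 + 1 / (\<alpha> * \<tau> / 4)) * L\<^sup>2 * n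
    - (a\<^sub>0 - 23 / 12 * (b * \<mu> * a\<^sub>0)) \<le> 2 * (\<tau> * v)"
  proof (rule linear[where E = "Q / 38416" and Q = Q and U = U and X = X])
    show "n \<le> 2 * (Q / 38416) + 2 * (X / 38416)"
      using 2 unfolding Q_def[symmetric] unfolding mult.assoc[of 2 \<epsilon>] \<epsilon> .
    show "(1 + 1 / (\<alpha> * \<tau> / 4)) * L\<^sup>2 * n \<le> 10 * (Q / 38416) + 10 * (X / 38416)"
      using 3 unfolding Q_def[symmetric] unfolding mult.assoc[of 10 \<epsilon>] \<epsilon> .
    show "(1 + z / 4) * a\<^sub>T \<le> a\<^sub>0 - U / 2 + 5 / 4 * (Q + 2 * (X / 38416) + \<tau> * v)"
      using 4 unfolding Q_def[symmetric] unfolding mult.assoc[of 2 \<epsilon>] \<epsilon> by (simp add: U_def algebra_simps)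
    show "Q \<le> U / 38416 + X / 38416 + \<tau> * v / 38416"
      using Y unfolding Q_def[symmetric] U_def[symmetric] unfolding \<epsilon> .
    show "b * \<mu> * a\<^sub>0 \<le> U / 38416" using 5 by (simp add: U_def \<epsilon>)
  qed (use 1[folded Q_def] \<open>Q \<ge> 0\<close> \<open>U \<ge> 0\<close> \<open>X \<ge> 0\<close> \<tau> nonneg in auto)
  moreover have eqs: "- \<mu> / 24 * \<tau> * \<beta> * d = - X / 24"
      "(1 - 23 / 12 * \<mu> * \<tau> * \<beta>) * a\<^sub>0 = a\<^sub>0 - 23 / 12 * (b * \<mu> * a\<^sub>0)"
    by (simp_all add: X_def b_def algebra_simps)
  ultimately show "- \<mu> / 24 * \<tau> * \<beta> * d + (24 * \<beta> / \<mu> + 12 * \<beta> / (5 * L)) * A + n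
    + (1 + \<alpha> * \<tau> / 4) * a\<^sub>T + (1 + 1 / (\<alpha> * \<tau> / 4)) * L\<^sup>2 * n
    - (1 - 23 / 12 * \<mu> * \<tau> * \<beta>) * a\<^sub>0 \<le> 2 * \<tau> * v"
    by (simp only: eqs z_def[symmetric] mult.assoc)
qed

section \<open>Expected progress of one round\<close>

context strongly_convex_sgd
begin

lemma local_sq_integrable:
  assumes i: "i \<in> H" and xy: "sq_integrable M (xbar k)" "sq_integrable M (y i k 0)" and "t \<le> T"
  shows "sq_integrable M (x i k t) \<and> sq_integrable M (y i k t)"
  using \<open>t \<le> T\<close>
proof (induction t)
  case 0
  then show ?case using xy i sq_integrable_cong[of M "x i k 0" "xbar k"] start_x by simp
next
  case (Suc t)
  then have IH: "sq_integrable M (x i k t)" "sq_integrable M (y i k t)" and t: "t < T" by auto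
  have "sq_integrable M (x i k (Suc t))
      \<longleftrightarrow> sq_integrable M (\<lambda>\<omega>. x i k t \<omega> - \<beta> k *\<^sub>R y i k t \<omega>)"
    using i t by (intro sq_integrable_cong) (simp add: step_x)
  moreover have "sq_integrable M (y i k (Suc t)) \<longleftrightarrow>
      sq_integrable M (\<lambda>\<omega>. (1 - \<alpha> k) *\<^sub>R y i k t \<omega> + \<alpha> k *\<^sub>R G i (x i k t \<omega>) (\<Delta> i k t \<omega>))"
    using i t by (intro sq_integrable_cong) (simp add: step_y)
  moreover have "sq_integrable M (\<lambda>\<omega>. G i (x i k t \<omega>) (\<Delta> i k t \<omega>))"
    using i t IH by (intro stochastic_grad_sq_integrable history_measurable) auto
  ultimately show ?case
    using IH by (simp add: sq_integrable_add sq_integrable_diff sq_integrable_scaleR)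
qed

text \<open>Byzantine messages are merely measurable, so they cannot be summed in the
  square-integrable class. The increment of the server iterate is square-integrable nevertheless,
  being dominated by the honest displacements.\<close>

lemma round_sq_integrable: "sq_integrable M (xbar k) \<and> (\<forall>i\<in>H. sq_integrable M (y i k 0))"
proof (induction k)
  case 0
  have "sq_integrable M (xbar 0) \<longleftrightarrow> sq_integrable M (\<lambda>_. x0)"
    by (intro sq_integrable_cong init_xbar)
  moreover have "sq_integrable M (y i 0 0) \<longleftrightarrow> sq_integrable M (\<lambda>_. y0 i)" if "i \<in> H" for i
    using that by (intro sq_integrable_cong init_y)
  ultimately show ?case by (simp add: sq_integrable_const)
next
  case (Suc k)
  have "sq_integrable M (\<lambda>\<omega>. xbar (Suc k) \<omega> - xbar k \<omega>)"
  proof (rule sq_integrable_bound[OF _ _ norm_server_step_power2_le])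
    show "(\<lambda>\<omega>. xbar (Suc k) \<omega> - xbar k \<omega>) \<in> borel_measurable M"
      using xbar_measurable by simp
    show "integrable M (\<lambda>\<omega>. (1 / real (card H)) * (\<Sum>i\<in>H. (norm (x i k T \<omega> - xbar k \<omega>))\<^sup>2))"
      using Suc local_sq_integrable
      by (intro integrable_mult_right Bochner_Integration.integrable_sum sq_integrable_integrable
          sq_integrable_diff) auto
  qed
  from sq_integrable_add[OF this, of "xbar k"] have "sq_integrable M (xbar (Suc k))"
    using Suc by simp
  moreover have "sq_integrable M (y i (Suc k) 0)" if "i \<in> H" for i
    using that Suc local_sq_integrable[of i k T] sq_integrable_cong[of M "y i (Suc k) 0" "y i k T"]
      start_y by simp
  ultimately show ?case by simp
qed

lemma iterates_sq_integrable:
  shows "sq_integrable M (xbar k)"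
    and "i \<in> H \<Longrightarrow> t \<le> T \<Longrightarrow> sq_integrable M (x i k t)"
    and "i \<in> H \<Longrightarrow> t \<le> T \<Longrightarrow> sq_integrable M (y i k t)"
  using round_sq_integrable local_sq_integrable by blast+

lemma grad_sq_integrable:
  assumes "i \<in> H" "sq_integrable M X"
  shows "sq_integrable M (\<lambda>\<omega>. grad (q i) (X \<omega>))"
  by (rule sq_integrable_lipschitz[OF _ assms(2) grad_measurable[OF assms(1)] smooth[OF assms(1)]])
    unfold_locales

lemma err_sq_integrable: "i \<in> H \<Longrightarrow> t \<le> T \<Longrightarrow> sq_integrable M (err i k t)"
  using sq_integrable_diff[OF iterates_sq_integrable(3) grad_sq_integrable[OF _ iterates_sq_integrable(1)]]
  unfolding grad_error_def[abs_def] .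

lemma sq_dist_integrable: "integrable M (sq_dist k)"
  by (intro sq_integrable_integrable sq_integrable_diff iterates_sq_integrable sq_integrable_const)

lemma mean_sq_err_integrable: "t \<le> T \<Longrightarrow> integrable M (mean_sq_err k t)"
  unfolding mean_sq_err_def[abs_def]
  by (intro integrable_mult_right Bochner_Integration.integrable_sum sq_integrable_integrable
      err_sq_integrable) auto

lemma V_fun_eq: "V_fun H q xs xbar y k = (\<lambda>\<omega>. sq_dist k \<omega> + mean_sq_err k 0 \<omega>)"
  by (simp add: fun_eq_iff V_fun_def W_fun_def mean_sq_err_def)

lemma V_integrable: "integrable M (V_fun H q xs xbar y k)"
  unfolding V_fun_eq using sq_dist_integrable mean_sq_err_integrable[of 0] by simp

text \<open>The new error is \<open>U + \<alpha> k *\<^sub>R \<xi>\<close>, where \<open>U\<close>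
  is a convex combination of the old error and the gradient drift \<open>g\<close> and is known to
  the history. The cross term with the noise vanishes in expectation, and convexity bounds
  \<open>U\<close>.\<close>

lemma expected_err_step:
  assumes i: "i \<in> H" and t: "t < T"
  shows "(LINT \<omega>|M. (norm (err i k (Suc t) \<omega>))\<^sup>2) \<le> (1 - \<alpha> k) * (LINT \<omega>|M. (norm (err i k t \<omega>))\<^sup>2)
    + \<alpha> k * L\<^sup>2 * (LINT \<omega>|M. (norm (x i k t \<omega> - xbar k \<omega>))\<^sup>2) + (\<alpha> k)\<^sup>2 * \<sigma>\<^sup>2"
proof -
  define \<xi> where "\<xi> = (\<lambda>\<omega>. G i (x i k t \<omega>) (\<Delta> i k t \<omega>) - grad (q i) (x i k t \<omega>))"
  define g where "g = (\<lambda>\<omega>. grad (q i) (x i k t \<omega>) - grad (q i) (xbar k \<omega>))"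
  define U where "U = (\<lambda>\<omega>. (1 - \<alpha> k) *\<^sub>R err i k t \<omega> + \<alpha> k *\<^sub>R g \<omega>)"
  have hx: "x i k t \<in> borel_measurable (hist k t)" "y i k t \<in> borel_measurable (hist k t)"
    "xbar k \<in> borel_measurable (hist k t)"
    using i t by (auto intro: history_measurable)
  have sx: "sq_integrable M (x i k t)" using i t by (intro iterates_sq_integrable) auto
  have hU: "U \<in> borel_measurable (hist k t)"
    unfolding U_def g_def grad_error_def
    using hx measurable_compose[OF hx(1) grad_measurable[OF i]]
      measurable_compose[OF hx(3) grad_measurable[OF i]] by simp
  have sg: "sq_integrable M g"
    unfolding g_def using i sx iterates_sq_integrable(1)
    by (intro sq_integrable_diff grad_sq_integrable) auto
  have sU: "sq_integrable M U"
    unfolding U_def using i t sg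
    by (intro sq_integrable_add sq_integrable_scaleR err_sq_integrable) auto
  have s\<xi>: "sq_integrable M \<xi>" and var: "(LINT \<omega>|M. (norm (\<xi> \<omega>))\<^sup>2) \<le> \<sigma>\<^sup>2"
    unfolding \<xi>_def using noise_sq_integrable[OF i t hx(1)] by auto
  have orth: "(LINT \<omega>|M. U \<omega> \<bullet> \<xi> \<omega>) = 0"
    unfolding \<xi>_def by (rule noise_orthogonal[OF i t hx(1) sx hU sU])
  have se: "integrable M (\<lambda>\<omega>. (norm (err i k t \<omega>))\<^sup>2)"
    using i t by (intro sq_integrable_integrable err_sq_integrable) auto
  have sd: "integrable M (\<lambda>\<omega>. (norm (x i k t \<omega> - xbar k \<omega>))\<^sup>2)"
    using sx iterates_sq_integrable(1) by (intro sq_integrable_integrable sq_integrable_diff)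
  have "(LINT \<omega>|M. (norm (err i k (Suc t) \<omega>))\<^sup>2)
      = (LINT \<omega>|M. (norm (U \<omega>))\<^sup>2 + 2 * \<alpha> k * (U \<omega> \<bullet> \<xi> \<omega>) + (\<alpha> k)\<^sup>2 * (norm (\<xi> \<omega>))\<^sup>2)"
  proof (intro Bochner_Integration.integral_cong refl)
    fix \<omega> assume "\<omega> \<in> space M"
    then have "err i k (Suc t) \<omega> = U \<omega> + \<alpha> k *\<^sub>R \<xi> \<omega>"
      using i t by (simp add: grad_error_def step_y U_def g_def \<xi>_def algebra_simps)
    then show "(norm (err i k (Suc t) \<omega>))\<^sup>2
        = (norm (U \<omega>))\<^sup>2 + 2 * \<alpha> k * (U \<omega> \<bullet> \<xi> \<omega>) + (\<alpha> k)\<^sup>2 * (norm (\<xi> \<omega>))\<^sup>2"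
      unfolding power2_norm_eq_inner
      by (simp add: inner_add inner_commute[of "\<xi> \<omega>" "U \<omega>"] power2_eq_square algebra_simps)
  qed
  also have "\<dots> = (LINT \<omega>|M. (norm (U \<omega>))\<^sup>2) + (\<alpha> k)\<^sup>2 * (LINT \<omega>|M. (norm (\<xi> \<omega>))\<^sup>2)"
    using sq_integrable_integrable[OF sU] sq_integrable_integrable[OF s\<xi>]
      sq_integrable_inner[OF sU s\<xi>] orth by simp
  also have "\<dots> \<le> (LINT \<omega>|M. (1 - \<alpha> k) * (norm (err i k t \<omega>))\<^sup>2
      + \<alpha> k * L\<^sup>2 * (norm (x i k t \<omega> - xbar k \<omega>))\<^sup>2) + (\<alpha> k)\<^sup>2 * \<sigma>\<^sup>2"
  proof (intro add_mono integral_mono mult_left_mono var)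
    fix \<omega>
    have "(norm (g \<omega>))\<^sup>2 \<le> (L * norm (x i k t \<omega> - xbar k \<omega>))\<^sup>2"
      unfolding g_def by (intro power_mono smooth i) auto
    then have "\<alpha> k * (norm (g \<omega>))\<^sup>2 \<le> \<alpha> k * (L\<^sup>2 * (norm (x i k t \<omega> - xbar k \<omega>))\<^sup>2)"
      using alpha_pos[of k] by (intro mult_left_mono) (auto simp: power_mult_distrib)
    moreover have "(norm (U \<omega>))\<^sup>2 \<le> (1 - \<alpha> k) * (norm (err i k t \<omega>))\<^sup>2 + \<alpha> k * (norm (g \<omega>))\<^sup>2"
      unfolding U_def using alpha_pos[of k] alpha_le_1[of k]
      by (intro norm_convex_combination_power2_le) auto
    ultimately show "(norm (U \<omega>))\<^sup>2 \<le> (1 - \<alpha> k) * (norm (err i k t \<omega>))\<^sup>2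
        + \<alpha> k * L\<^sup>2 * (norm (x i k t \<omega> - xbar k \<omega>))\<^sup>2"
      unfolding mult.assoc by linarith
  qed (use sq_integrable_integrable[OF sU] se sd in auto)
  also have "\<dots> = (1 - \<alpha> k) * (LINT \<omega>|M. (norm (err i k t \<omega>))\<^sup>2)
      + \<alpha> k * L\<^sup>2 * (LINT \<omega>|M. (norm (x i k t \<omega> - xbar k \<omega>))\<^sup>2) + (\<alpha> k)\<^sup>2 * \<sigma>\<^sup>2"
    using se sd by simp
  finally show ?thesis .
qed

lemma expectation_mean_sq_err:
  assumes "t \<le> T"
  shows "(LINT \<omega>|M. mean_sq_err k t \<omega>)
    = (1 / real (card H)) * (\<Sum>i\<in>H. LINT \<omega>|M. (norm (err i k t \<omega>))\<^sup>2)"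
  unfolding mean_sq_err_def using assms
  by (subst integral_mult_right_zero, subst Bochner_Integration.integral_sum)
    (auto intro!: sq_integrable_integrable err_sq_integrable)

text \<open>Inserting the displacement bound turns the drift into memory with coefficient
  \<open>2 * L\<^sup>2 * (\<beta> k)\<^sup>2 * real T\<close>, the \<open>p\<close> of the scalar
  recursion.\<close>

lemma expected_mean_sq_err_step:
  assumes t: "t < T"
  shows "(LINT \<omega>|M. mean_sq_err k (Suc t) \<omega>) \<le> (1 - \<alpha> k) * (LINT \<omega>|M. mean_sq_err k t \<omega>)
    + \<alpha> k * (2 * L\<^sup>2 * (\<beta> k)\<^sup>2 * real T) *
      ((\<Sum>s<t. LINT \<omega>|M. mean_sq_err k s \<omega>) + real T * (L\<^sup>2 * (LINT \<omega>|M. sq_dist k \<omega>)))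
    + (\<alpha> k)\<^sup>2 * \<sigma>\<^sup>2"
proof -
  let ?n = "real (card H)"
  let ?dx = "\<lambda>i \<omega>. (norm (x i k t \<omega> - xbar k \<omega>))\<^sup>2"
  have dx: "integrable M (?dx i)" if "i \<in> H" for i
    using that t by (intro sq_integrable_integrable sq_integrable_diff iterates_sq_integrable) auto
  have ms: "integrable M (mean_sq_err k s)" if "s < t" for s
    using that t by (intro mean_sq_err_integrable) auto
  have sum_ms: "integrable M (\<lambda>\<omega>. \<Sum>s<t. mean_sq_err k s \<omega>)"
    by (intro Bochner_Integration.integrable_sum ms) auto
  have sum_ms_eq: "(LINT \<omega>|M. (\<Sum>s<t. mean_sq_err k s \<omega>)) = (\<Sum>s<t. LINT \<omega>|M. mean_sq_err k s \<omega>)"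
    by (intro Bochner_Integration.integral_sum ms) auto
  have "(1 / ?n) * (\<Sum>i\<in>H. LINT \<omega>|M. ?dx i \<omega>) = (LINT \<omega>|M. (1 / ?n) * (\<Sum>i\<in>H. ?dx i \<omega>))"
    using dx by (subst integral_mult_right_zero, subst Bochner_Integration.integral_sum) auto
  also have "\<dots> \<le> (LINT \<omega>|M. 2 * (\<beta> k)\<^sup>2 * real T *
      ((\<Sum>s<t. mean_sq_err k s \<omega>) + real T * L\<^sup>2 * sq_dist k \<omega>))"
    using t ms sq_dist_integrable
    by (intro integral_mono mean_displacement_power2_le integrable_mult_right
        Bochner_Integration.integrable_add Bochner_Integration.integrable_sum dx) auto
  also have "\<dots> = 2 * (\<beta> k)\<^sup>2 * real T *
      ((\<Sum>s<t. LINT \<omega>|M. mean_sq_err k s \<omega>) + real T * L\<^sup>2 * (LINT \<omega>|M. sq_dist k \<omega>))"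
    using sum_ms sum_ms_eq sq_dist_integrable[of k] by simp
  finally have disp: "(1 / ?n) * (\<Sum>i\<in>H. LINT \<omega>|M. ?dx i \<omega>) \<le> \<dots>" .
  have "(LINT \<omega>|M. mean_sq_err k (Suc t) \<omega>) \<le> (1 / ?n) * (\<Sum>i\<in>H.
      (1 - \<alpha> k) * (LINT \<omega>|M. (norm (err i k t \<omega>))\<^sup>2) + \<alpha> k * L\<^sup>2 * (LINT \<omega>|M. ?dx i \<omega>)
      + (\<alpha> k)\<^sup>2 * \<sigma>\<^sup>2)"
    using t by (subst expectation_mean_sq_err) (auto intro!: divide_right_mono sum_mono expected_err_step)
  also have "\<dots> = (1 - \<alpha> k) * (LINT \<omega>|M. mean_sq_err k t \<omega>)
      + \<alpha> k * L\<^sup>2 * ((1 / ?n) * (\<Sum>i\<in>H. LINT \<omega>|M. ?dx i \<omega>)) + (\<alpha> k)\<^sup>2 * \<sigma>\<^sup>2"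
    using card_H_pos
    by (simp only: expectation_mean_sq_err[OF less_imp_le[OF t]] sum.distrib
        sum_distrib_left[symmetric] sum_constant) (simp add: algebra_simps add_divide_distrib diff_divide_distrib)
  also have "\<dots> \<le> (1 - \<alpha> k) * (LINT \<omega>|M. mean_sq_err k t \<omega>)
      + \<alpha> k * L\<^sup>2 * (2 * (\<beta> k)\<^sup>2 * real T *
      ((\<Sum>s<t. LINT \<omega>|M. mean_sq_err k s \<omega>) + real T * L\<^sup>2 * (LINT \<omega>|M. sq_dist k \<omega>)))
      + (\<alpha> k)\<^sup>2 * \<sigma>\<^sup>2"
    using disp alpha_pos[of k] by (intro add_mono mult_left_mono order_refl) auto
  finally show ?thesis by (simp add: mult_ac)
qed

text \<open>A function of the number \<open>b\<close>, so that the same expression serves for the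
  random size and for a constant one.\<close>

definition round_factor :: "nat \<Rightarrow> nat \<Rightarrow> real" where
  "round_factor k b = 1 - 23 * \<mu> * real T * \<beta> k / 12
    + 17 * L * real T * \<beta> k * real b / (3 * real (card H))"

text \<open>At most \<open>f\<close> Byzantine agents are kept, so the random factor takes finitely
  many values and is bounded.\<close>

lemma round_factor_integrable:
  "integrable M (\<lambda>\<omega>. round_factor k (card (F k \<omega> - H)) * V_fun H q xs xbar y k \<omega>)"
proof (rule Bochner_Integration.integrable_bound)
  let ?r = "\<lambda>\<omega>. round_factor k (card (F k \<omega> - H))"
  define K where "K = Max ((\<lambda>b. \<bar>round_factor k b\<bar>) ` {..f})"
  show "integrable M (\<lambda>\<omega>. K * V_fun H q xs xbar y k \<omega>)"
    using V_integrable by simp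
  have "?r \<in> borel_measurable M"
    using measurable_compose[OF filter_measurable_UNIV, of "\<lambda>A. round_factor k (card (A - H))" borel k]
    by simp
  then show "(\<lambda>\<omega>. ?r \<omega> * V_fun H q xs xbar y k \<omega>) \<in> borel_measurable M"
    using V_integrable by simp
  have "\<bar>?r \<omega>\<bar> \<le> K" if "\<omega> \<in> space M" for \<omega>
    unfolding K_def using card_kept_byzantine_le[OF that] by (intro Max_ge) auto
  then show "AE \<omega> in M. norm (?r \<omega> * V_fun H q xs xbar y k \<omega>) \<le> norm (K * V_fun H q xs xbar y k \<omega>)"
    by (intro AE_I2) (auto simp: abs_mult intro!: mult_right_mono intro: order_trans[OF _ abs_ge_self])
qed

end

locale small_step_sgd = strongly_convex_sgd +
  assumes alpha_small: "\<And>k. \<alpha> k \<le> \<mu> / (8^4 * (L + 1)^4 * real T)"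
    and ratio_small: "\<And>k. \<beta> k / \<alpha> k \<le> \<mu> / (14^4 * (L + 1)^4 * real T)"
begin

text \<open>The random factor multiplies only the potential; everything else sits in one bracket
  with deterministic coefficients. The expectation of the bracket thus needs only expected errors,
  distances and server steps. The coefficients match because
  \<open>- 23 / 12 - 1 / 24 = - 2 + 1 / 24\<close>.\<close>

lemma V_next_round_le:
  fixes k :: nat
  assumes \<omega>: "\<omega> \<in> space M"
  defines "\<eta> \<equiv> \<alpha> k * real T / 4"
  shows "V_fun H q xs xbar y (Suc k) \<omega>
    \<le> round_factor k (card (F k \<omega> - H)) * V_fun H q xs xbar y k \<omega>
      + (- \<mu> / 24 * real T * \<beta> k * sq_dist k \<omega>
        + (24 * \<beta> k / \<mu> + 12 * \<beta> k / (5 * L)) * (\<Sum>t<T. mean_sq_err k t \<omega>)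
        + (norm (xbar (Suc k) \<omega> - xbar k \<omega>))\<^sup>2
        + (1 + \<eta>) * mean_sq_err k T \<omega>
        + (1 + 1 / \<eta>) * L\<^sup>2 * (norm (xbar (Suc k) \<omega> - xbar k \<omega>))\<^sup>2
        - (1 - 23 / 12 * \<mu> * real T * \<beta> k) * mean_sq_err k 0 \<omega>)"
proof -
  have "\<eta> > 0" using alpha_pos[of k] T_ge_1 by (simp add: \<eta>_def)
  define c where "c = 17 * L * real T * \<beta> k * real (card (F k \<omega> - H)) / (3 * real (card H))"
  \<comment> \<open>The Byzantine loss arises for the distance only. Granting it to the errors too
    enlarges the right-hand side and lets one factor multiply the whole potential.\<close>
  have "c * mean_sq_err k 0 \<omega> \<ge> 0"
    using L_pos beta_pos[of k] mean_sq_err_nonneg[of k 0 \<omega>] by (simp add: c_def)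
  moreover have "round_factor k (card (F k \<omega> - H)) * V_fun H q xs xbar y k \<omega>
      + - \<mu> / 24 * real T * \<beta> k * sq_dist k \<omega>
    = (1 + (- 2 * \<mu> + \<mu> / 24) * real T * \<beta> k + c) * sq_dist k \<omega>
      + (1 - 23 / 12 * \<mu> * real T * \<beta> k) * mean_sq_err k 0 \<omega> + c * mean_sq_err k 0 \<omega>"
    unfolding round_factor_def c_def[symmetric] V_fun_eq by (simp add: field_simps)
  ultimately show ?thesis
    using sq_dist_next_round_le[OF \<omega>, of k, folded c_def] mean_sq_err_next_round_le[OF \<omega> \<open>\<eta> > 0\<close>, of k]
      V_fun_eq[of "Suc k"] by simp
qed

lemma expected_round:
  "(LINT \<omega>|M. V_fun H q xs xbar y (Suc k) \<omega>)
    \<le> (LINT \<omega>|M. round_factor k (card (F k \<omega> - H)) * V_fun H q xs xbar y k \<omega>)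
      + 2 * real T * ((\<alpha> k)\<^sup>2 * \<sigma>\<^sup>2)"
proof -
  define a where "a = (\<lambda>t. LINT \<omega>|M. mean_sq_err k t \<omega>)"
  define d where "d = (LINT \<omega>|M. sq_dist k \<omega>)"
  define n where "n = (LINT \<omega>|M. (norm (xbar (Suc k) \<omega> - xbar k \<omega>))\<^sup>2)"
  define A where "A = (\<Sum>t<T. a t)"
  define p where "p = 2 * L\<^sup>2 * (\<beta> k)\<^sup>2 * real T"
  define v where "v = (\<alpha> k)\<^sup>2 * \<sigma>\<^sup>2"
  define R where "R = a 0 + 2 * p * real T * (L\<^sup>2 * d) + real T * v"
  define \<eta> where "\<eta> = \<alpha> k * real T / 4"
  have T: "1 \<le> real T" using T_ge_1 by simp
  have a: "a t \<ge> 0" for t unfolding a_def by (intro Bochner_Integration.integral_nonneg mean_sq_err_nonneg)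
  have d: "d \<ge> 0" unfolding d_def by (intro Bochner_Integration.integral_nonneg) auto
  have v: "v \<ge> 0" by (simp add: v_def)
  have p: "p \<ge> 0" by (simp add: p_def)
  have nint: "integrable M (\<lambda>\<omega>. (norm (xbar (Suc k) \<omega> - xbar k \<omega>))\<^sup>2)"
    by (intro sq_integrable_integrable sq_integrable_diff iterates_sq_integrable)
  have Aint: "integrable M (\<lambda>\<omega>. \<Sum>t<T. mean_sq_err k t \<omega>)"
    by (intro Bochner_Integration.integrable_sum mean_sq_err_integrable) auto
  have A: "(LINT \<omega>|M. (\<Sum>t<T. mean_sq_err k t \<omega>)) = A"
    unfolding A_def a_def by (intro Bochner_Integration.integral_sum mean_sq_err_integrable) auto
  have n: "n \<le> 2 * (\<beta> k)\<^sup>2 * real T * (A + real T * L\<^sup>2 * d)"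
  proof -
    have "n \<le> (LINT \<omega>|M. 2 * (\<beta> k)\<^sup>2 * real T *
        ((\<Sum>t<T. mean_sq_err k t \<omega>) + real T * L\<^sup>2 * sq_dist k \<omega>))"
      unfolding n_def using nint Aint sq_dist_integrable
      by (intro integral_mono server_step_power2_le integrable_mult_right Bochner_Integration.integrable_add)
        auto
    also have "\<dots> = 2 * (\<beta> k)\<^sup>2 * real T * (A + real T * L\<^sup>2 * d)"
      using Aint sq_dist_integrable[of k] A by (simp add: d_def)
    finally show ?thesis .
  qed
  note budget = round_budget[OF mu T alpha_pos beta_pos alpha_small alpha_le_1 ratio_small d a[of 0] v p_def R_def]
  \<comment> \<open>The smallness of \<open>p\<close> is extracted by letting \<open>A\<close>,
    \<open>a\<^sub>T\<close> and \<open>n\<close> equal their own bounds. It is needed before the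
    error recursion can supply the true bounds for the first conclusion of
    \<open>budget\<close>.\<close>
  have p_half: "p * real T \<le> 1 / 2"
    by (rule budget(2)[OF order_refl order_refl order_refl])
  have step: "a (Suc t) \<le> (1 - \<alpha> k) * a t + \<alpha> k * p * ((\<Sum>s<t. a s) + real T * (L\<^sup>2 * d)) + v"
    if "t < T" for t
    using expected_mean_sq_err_step[OF that, of k] by (simp add: a_def d_def p_def v_def)
  have "0 \<le> L\<^sup>2 * d" using d by simp
  note contraction = perturbed_contraction[OF less_imp_le[OF alpha_pos] alpha_le_1 p p_half this v a step]
  have "A \<le> (\<Sum>t<T. R)" unfolding A_def R_def by (intro sum_mono contraction(1)) auto
  then have AR: "A \<le> real T * R" by simp
  have aT: "a T \<le> (1 - \<alpha> k * real T + (\<alpha> k * real T)\<^sup>2) * a 0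
      + \<alpha> k * real T * (p * real T) * (R + L\<^sup>2 * d) + real T * v"
    unfolding R_def by (rule contraction(2))
  have "(LINT \<omega>|M. V_fun H q xs xbar y (Suc k) \<omega>)
    \<le> (LINT \<omega>|M. round_factor k (card (F k \<omega> - H)) * V_fun H q xs xbar y k \<omega>
      + (- \<mu> / 24 * real T * \<beta> k * sq_dist k \<omega>
        + (24 * \<beta> k / \<mu> + 12 * \<beta> k / (5 * L)) * (\<Sum>t<T. mean_sq_err k t \<omega>)
        + (norm (xbar (Suc k) \<omega> - xbar k \<omega>))\<^sup>2
        + (1 + \<eta>) * mean_sq_err k T \<omega>
        + (1 + 1 / \<eta>) * L\<^sup>2 * (norm (xbar (Suc k) \<omega> - xbar k \<omega>))\<^sup>2
        - (1 - 23 / 12 * \<mu> * real T * \<beta> k) * mean_sq_err k 0 \<omega>))"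
    unfolding \<eta>_def
    using nint Aint sq_dist_integrable mean_sq_err_integrable V_integrable round_factor_integrable
    by (intro integral_mono V_next_round_le Bochner_Integration.integrable_add
        Bochner_Integration.integrable_diff integrable_mult_right) auto
  also have "\<dots> = (LINT \<omega>|M. round_factor k (card (F k \<omega> - H)) * V_fun H q xs xbar y k \<omega>)
      + (- \<mu> / 24 * real T * \<beta> k * d + (24 * \<beta> k / \<mu> + 12 * \<beta> k / (5 * L)) * A + n
        + (1 + \<eta>) * a T + (1 + 1 / \<eta>) * L\<^sup>2 * n - (1 - 23 / 12 * \<mu> * real T * \<beta> k) * a 0)"
    using nint Aint sq_dist_integrable mean_sq_err_integrable round_factor_integrable A
    by (simp add: a_def d_def n_def)
  also have "\<dots> \<le> (LINT \<omega>|M. round_factor k (card (F k \<omega> - H)) * V_fun H q xs xbar y k \<omega>) + 2 * real T * v"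
    unfolding \<eta>_def using budget(1)[OF AR aT n] by simp
  finally show ?thesis by (simp add: v_def)
qed

end

section \<open>The two bounds\<close>

text \<open>For \<open>m = 1 + h + real k\<close>, multiplication by \<open>m\<^sup>2\<close> turns
  \<open>1 - 2 / m\<close> into \<open>m\<^sup>2 - 2 * m\<close>, which is below
  \<open>(m - 1)\<^sup>2\<close>, the weight of the previous round and \<open>h\<^sup>2\<close> at
  the start. The weighted sequence gains at most \<open>K\<close> per round, and
  \<open>k + 1\<close> gains are at most \<open>m * K\<close>.\<close>

lemma harmonic_recursion_bound:
  fixes u :: "nat \<Rightarrow> real"
  assumes h: "h > 0" and K: "K \<ge> 0" and u: "\<And>k. u k \<ge> 0"
    and step: "\<And>k. u (Suc k) \<le> (1 - 2 / (1 + h + real k)) * u k + K / (1 + h + real k)\<^sup>2"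
  shows "u (Suc k) \<le> h\<^sup>2 * u 0 / (1 + h + real k)\<^sup>2 + K / (1 + h + real k)"
proof -
  have weighted: "(1 + h + real k)\<^sup>2 * u (Suc k) \<le> (h + real k)\<^sup>2 * u k + K" for k
  proof -
    define m where "m = 1 + h + real k"
    have "m > 0" using h by (simp add: m_def)
    have "m\<^sup>2 * u (Suc k) \<le> m\<^sup>2 * ((1 - 2 / m) * u k + K / m\<^sup>2)"
      using step[of k] unfolding m_def by (intro mult_left_mono) auto
    also have "\<dots> = (m\<^sup>2 - 2 * m) * u k + K"
      using \<open>m > 0\<close> by (simp add: power2_eq_square field_simps)
    also have "\<dots> \<le> (m - 1)\<^sup>2 * u k + K"
      using u[of k] by (intro add_right_mono mult_right_mono) (auto simp: power2_eq_square algebra_simps)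
    finally show ?thesis by (simp add: m_def)
  qed
  have "(1 + h + real k)\<^sup>2 * u (Suc k) \<le> h\<^sup>2 * u 0 + (real k + 1) * K"
  proof (induction k)
    case 0
    then show ?case using weighted[of 0] by simp
  next
    case (Suc k)
    then show ?case using weighted[of "Suc k"] by (simp add: algebra_simps)
  qed
  also have "\<dots> \<le> h\<^sup>2 * u 0 + (1 + h + real k) * K"
    using h K by (intro add_left_mono mult_right_mono) auto
  finally have "u (Suc k) \<le> (h\<^sup>2 * u 0 + (1 + h + real k) * K) / (1 + h + real k)\<^sup>2"
    using h by (subst pos_le_divide_eq) (auto simp: mult.commute)
  also have "\<dots> = h\<^sup>2 * u 0 / (1 + h + real k)\<^sup>2 + K / (1 + h + real k)"
    using h by (simp add: add_divide_distrib power2_eq_square)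
  finally show ?thesis .
qed

context small_step_sgd
begin

abbreviation V where
  "V \<equiv> V_fun H q xs xbar y"

abbreviation noise_bound :: "real \<Rightarrow> real" where
  "noise_bound a \<equiv> 150 * (L + 1)^3 * (real T)\<^sup>2 * \<sigma>\<^sup>2 * a\<^sup>2 / \<mu>
    + 128 * (L + 1)\<^sup>2 * (real T)\<^sup>2 * \<sigma>\<^sup>2 * real f * a\<^sup>2 / real (card H)"

text \<open>Comparison with the first summand suffices, by
  \<open>\<mu> \<le> L + 1 \<le> (L + 1)^3\<close> and \<open>T \<le> T\<^sup>2\<close>.\<close>

lemma noise_bound_ge: "2 * real T * (a\<^sup>2 * \<sigma>\<^sup>2) \<le> noise_bound a"
proof -
  have "\<mu> \<le> (L + 1)^3"
  proof -
    have "(L + 1) ^ 1 \<le> (L + 1)^3" using L_pos by (intro power_increasing) auto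
    then show ?thesis using mu by simp
  qed
  then have "1 \<le> (L + 1)^3 / \<mu>" using mu by simp
  moreover have "real T \<le> (real T)\<^sup>2" using T_ge_1 by (simp add: power2_eq_square)
  ultimately have "2 * (real T * 1) \<le> 150 * ((real T)\<^sup>2 * ((L + 1)^3 / \<mu>))"
    by (intro mult_mono) auto
  then have "2 * (real T * 1) * (a\<^sup>2 * \<sigma>\<^sup>2) \<le> 150 * ((real T)\<^sup>2 * ((L + 1)^3 / \<mu>)) * (a\<^sup>2 * \<sigma>\<^sup>2)"
    by (intro mult_right_mono) auto
  also have "\<dots> = 150 * (L + 1)^3 * (real T)\<^sup>2 * \<sigma>\<^sup>2 * a\<^sup>2 / \<mu>" by simp
  also have "\<dots> \<le> noise_bound a" by simp
  finally show ?thesis by (simp only: mult.assoc mult_1_right)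
qed

lemma round_bound:
  "(LINT \<omega>|M. V (Suc k) \<omega>)
    \<le> (LINT \<omega>|M. round_factor k (card (kept_byzantine H F k \<omega>)) * V k \<omega>) + noise_bound (\<alpha> k)"
  using expected_round[of k] noise_bound_ge[of "\<alpha> k"] by (simp add: kept_byzantine_def)

lemma round_bound_const:
  assumes "AE \<omega> in M. card (kept_byzantine H F k \<omega>) = b"
  shows "(LINT \<omega>|M. V (Suc k) \<omega>) \<le> round_factor k b * (LINT \<omega>|M. V k \<omega>) + noise_bound (\<alpha> k)"
proof -
  have "(LINT \<omega>|M. round_factor k (card (kept_byzantine H F k \<omega>)) * V k \<omega>)
      = (LINT \<omega>|M. round_factor k b * V k \<omega>)"
  proof (rule integral_cong_AE)
    show "AE \<omega> in M. round_factor k (card (kept_byzantine H F k \<omega>)) * V k \<omega> = round_factor k b * V k \<omega>"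
      using assms by eventually_elim simp
  qed (use round_factor_integrable V_integrable in \<open>auto simp: kept_byzantine_def\<close>)
  then show ?thesis using round_bound[of k] by simp
qed

lemma V_nonneg: "V k \<omega> \<ge> 0"
  using mean_sq_err_nonneg by (simp add: V_fun_eq)

text \<open>The Byzantine loss is at most \<open>17 / 9 = 68 / 36\<close> against a gain of
  \<open>23 / 12 = 69 / 36\<close>, in units of \<open>\<mu> * real T * \<beta> k\<close>.\<close>

lemma round_factor_le:
  assumes f: "real f / (real N - real f) \<le> \<mu> / (3 * L)" and b: "b \<le> f"
  shows "round_factor k b \<le> 1 - \<mu> * real T * \<beta> k / 36"
proof -
  have "real b / real (card H) \<le> real f / real (card H)" using b by (simp add: divide_right_mono)
  also have "\<dots> \<le> \<mu> / (3 * L)" using f N_eq by simp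
  finally have "17 * L * real T * \<beta> k / 3 * (real b / real (card H))
      \<le> 17 * L * real T * \<beta> k / 3 * (\<mu> / (3 * L))"
    using L_pos beta_pos[of k] by (intro mult_left_mono) auto
  also have "\<dots> = 17 / 9 * (\<mu> * real T * \<beta> k)" using L_pos by simp
  finally have "17 * L * real T * \<beta> k * real b / (3 * real (card H)) \<le> 17 / 9 * (\<mu> * real T * \<beta> k)"
    by simp
  then show ?thesis unfolding round_factor_def mult.assoc by argo
qed

lemma harmonic_bound:
  assumes f: "real f / (real N - real f) \<le> \<mu> / (3 * L)" and C\<beta>: "C\<beta> = 72 / (\<mu> * real T)"
  shows "(LINT \<omega>|M. V (Suc k) \<omega>) \<le> h\<^sup>2 * (LINT \<omega>|M. V 0 \<omega>) / (1 + h + real k)\<^sup>2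
    + noise_bound C\<alpha> / (1 + h + real k)"
proof (rule harmonic_recursion_bound)
  show "h > 0" using h_gt_1 by simp
  show "0 \<le> noise_bound C\<alpha>"
    using noise_bound_ge[of C\<alpha>] by (rule order_trans[rotated]) simp
  show "0 \<le> (LINT \<omega>|M. V k \<omega>)" for k
    by (intro Bochner_Integration.integral_nonneg V_nonneg)
  show "(LINT \<omega>|M. V (Suc k) \<omega>) \<le> (1 - 2 / (1 + h + real k)) * (LINT \<omega>|M. V k \<omega>)
      + noise_bound C\<alpha> / (1 + h + real k)\<^sup>2" for k
  proof -
    have rate: "\<mu> * real T * \<beta> k / 36 = 2 / (1 + h + real k)"
    proof -
      define m where "m = 1 + h + real k"
      then have "\<beta> k = C\<beta> / m" by (simp add: beta_eq)
      then show ?thesis unfolding m_def[symmetric] using mu T_ge_1 by (simp add: C\<beta>)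
    qed
    \<comment> \<open>The bound is uniform over \<open>b \<le> f\<close> and the potential is
      nonnegative, so the random size can be eliminated under the integral.\<close>
    have "round_factor k b \<le> 1 - 2 / (1 + h + real k)" if "b \<le> f" for b
      using round_factor_le[OF f that, of k] unfolding rate .
    then have "(LINT \<omega>|M. round_factor k (card (kept_byzantine H F k \<omega>)) * V k \<omega>)
        \<le> (LINT \<omega>|M. (1 - 2 / (1 + h + real k)) * V k \<omega>)"
      using card_kept_byzantine_le[of _ k]
        round_factor_integrable V_integrable
      by (intro integral_mono mult_right_mono V_nonneg) (auto simp: kept_byzantine_def)
    moreover have "noise_bound (\<alpha> k) = noise_bound C\<alpha> / (1 + h + real k)\<^sup>2"
      by (simp add: alpha_eq power_divide add_divide_distrib mult.commute)
    ultimately show ?thesis using round_bound[of k] by simp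
  qed
qed

end

theorem theorem1:
  fixes M :: "'w measure"
    and Z :: "'z measure"
    and N f :: nat
    and H :: "nat set"
    and q :: "nat \<Rightarrow> real ^ 'd \<Rightarrow> real"
    and G :: "nat \<Rightarrow> real ^ 'd \<Rightarrow> 'z \<Rightarrow> real ^ 'd"
    and \<Delta> :: "nat \<Rightarrow> nat \<Rightarrow> nat \<Rightarrow> 'w \<Rightarrow> 'z"
    and T :: nat
    and L \<sigma> C\<alpha> C\<beta> h \<mu> :: real
    and \<alpha> \<beta> :: "nat \<Rightarrow> real"
    and x0 xs :: "real ^ 'd"
    and y0 :: "nat \<Rightarrow> real ^ 'd"
    and xbar :: "nat \<Rightarrow> 'w \<Rightarrow> real ^ 'd"
    and x y :: "nat \<Rightarrow> nat \<Rightarrow> nat \<Rightarrow> 'w \<Rightarrow> real ^ 'd"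
    and F :: "nat \<Rightarrow> 'w \<Rightarrow> nat set"
    and V :: "nat \<Rightarrow> 'w \<Rightarrow> real"
    and B :: "nat \<Rightarrow> 'w \<Rightarrow> nat set"
  assumes setting:
      "byzantine_local_sgd M Z N f H q G \<Delta> T L \<sigma> C\<alpha> C\<beta> h \<alpha> \<beta> x0 y0 xbar x y F"
    and T_gt_1: "T > 1"
    and mu: "0 < \<mu>" "\<mu> \<le> L"
    and strongly_convex: "\<And>u v. (v - u) \<bullet> (grad (avg_cost H q) v - grad (avg_cost H q) u)
           \<ge> \<mu> * (norm (v - u))\<^sup>2"
    and xs: "minimizers (avg_cost H q) = {xs}"
    and V_def: "V = V_fun H q xs xbar y"
    and B_def: "B = kept_byzantine H F"
    and alpha_small: "\<And>k. \<alpha> k \<le> \<mu> / (8^4 * (L + 1)^4 * real T)"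
    and beta_small: "\<And>k. \<beta> k \<le> \<mu> / (12^4 * L\<^sup>2 * real T)"
    and ratio_small: "\<And>k. \<beta> k / \<alpha> k \<le> \<mu> / (14^4 * (L + 1)^4 * real T)"
  shows
    "(\<forall>k. integrable M (V k)) \<and>
     (\<forall>k. (LINT \<omega>|M. V (Suc k) \<omega>)
        \<le> (LINT \<omega>|M. (1 - 23 * \<mu> * real T * \<beta> k / 12
                        + 17 * L * real T * \<beta> k * real (card (B k \<omega>)) / (3 * real (card H))) * V k \<omega>)
          + 150 * (L + 1)^3 * (real T)\<^sup>2 * \<sigma>\<^sup>2 * (\<alpha> k)\<^sup>2 / \<mu>
          + 128 * (L + 1)\<^sup>2 * (real T)\<^sup>2 * \<sigma>\<^sup>2 * real f * (\<alpha> k)\<^sup>2 / real (card H)) \<and>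
     (\<forall>k b. (AE \<omega> in M. card (B k \<omega>) = b) \<longrightarrow>
        (LINT \<omega>|M. V (Suc k) \<omega>)
        \<le> (1 - 23 * \<mu> * real T * \<beta> k / 12
             + 17 * L * real T * \<beta> k * real b / (3 * real (card H))) * (LINT \<omega>|M. V k \<omega>)
          + 150 * (L + 1)^3 * (real T)\<^sup>2 * \<sigma>\<^sup>2 * (\<alpha> k)\<^sup>2 / \<mu>
          + 128 * (L + 1)\<^sup>2 * (real T)\<^sup>2 * \<sigma>\<^sup>2 * real f * (\<alpha> k)\<^sup>2 / real (card H)) \<and>
     (real f / (real N - real f) \<le> \<mu> / (3 * L) \<and>
      C\<alpha> \<ge> 84^4 * (L + 1)^4 / (6 * \<mu>\<^sup>2) \<and>
      C\<beta> = 72 / (\<mu> * real T) \<and>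
      h \<ge> max (8^4 * (L + 1)^4 * real T * C\<alpha> / \<mu>) (72^4 * L\<^sup>2 / (18 * \<mu>\<^sup>2)) \<longrightarrow>
        (\<forall>k. (LINT \<omega>|M. V (Suc k) \<omega>)
           \<le> h\<^sup>2 * (LINT \<omega>|M. V 0 \<omega>) / (1 + h + real k)\<^sup>2
             + 150 * (L + 1)^3 * (real T)\<^sup>2 * \<sigma>\<^sup>2 * C\<alpha>\<^sup>2 / (\<mu> * (1 + h + real k))
             + 128 * (L + 1)\<^sup>2 * (real T)\<^sup>2 * \<sigma>\<^sup>2 * real f * C\<alpha>\<^sup>2
                 / ((1 + h + real k) * real (card H))))"
proof -
  interpret byzantine_local_sgd M Z N f H q G \<Delta> T L \<sigma> C\<alpha> C\<beta> h \<alpha> \<beta> x0 y0 xbar x y F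
    by (rule setting)
  interpret small_step_sgd M Z N f H q G \<Delta> T L \<sigma> C\<alpha> C\<beta> h \<alpha> \<beta> x0 y0 xbar x y F \<mu> xs
    by unfold_locales (fact mu strongly_convex xs alpha_small ratio_small)+
  show ?thesis
    unfolding V_def B_def
  proof (intro conjI allI impI)
    show "integrable M (V_fun H q xs xbar y k)" for k by (rule V_integrable)
  next
    fix k
    show "(LINT \<omega>|M. V_fun H q xs xbar y (Suc k) \<omega>)
        \<le> (LINT \<omega>|M. (1 - 23 * \<mu> * real T * \<beta> k / 12
              + 17 * L * real T * \<beta> k * real (card (kept_byzantine H F k \<omega>)) / (3 * real (card H)))
            * V_fun H q xs xbar y k \<omega>)
          + 150 * (L + 1)^3 * (real T)\<^sup>2 * \<sigma>\<^sup>2 * (\<alpha> k)\<^sup>2 / \<mu>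
          + 128 * (L + 1)\<^sup>2 * (real T)\<^sup>2 * \<sigma>\<^sup>2 * real f * (\<alpha> k)\<^sup>2 / real (card H)"
      using round_bound[of k] unfolding round_factor_def by simp
  next
    fix k b
    assume "AE \<omega> in M. card (kept_byzantine H F k \<omega>) = b"
    then show "(LINT \<omega>|M. V_fun H q xs xbar y (Suc k) \<omega>)
        \<le> (1 - 23 * \<mu> * real T * \<beta> k / 12
              + 17 * L * real T * \<beta> k * real b / (3 * real (card H)))
            * (LINT \<omega>|M. V_fun H q xs xbar y k \<omega>)
          + 150 * (L + 1)^3 * (real T)\<^sup>2 * \<sigma>\<^sup>2 * (\<alpha> k)\<^sup>2 / \<mu>
          + 128 * (L + 1)\<^sup>2 * (real T)\<^sup>2 * \<sigma>\<^sup>2 * real f * (\<alpha> k)\<^sup>2 / real (card H)"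
      using round_bound_const[of k b] unfolding round_factor_def by simp
  next
    fix k
    assume "real f / (real N - real f) \<le> \<mu> / (3 * L) \<and>
      C\<alpha> \<ge> 84^4 * (L + 1)^4 / (6 * \<mu>\<^sup>2) \<and>
      C\<beta> = 72 / (\<mu> * real T) \<and>
      h \<ge> max (8^4 * (L + 1)^4 * real T * C\<alpha> / \<mu>) (72^4 * L\<^sup>2 / (18 * \<mu>\<^sup>2))"
    then show "(LINT \<omega>|M. V_fun H q xs xbar y (Suc k) \<omega>)
           \<le> h\<^sup>2 * (LINT \<omega>|M. V_fun H q xs xbar y 0 \<omega>) / (1 + h + real k)\<^sup>2
             + 150 * (L + 1)^3 * (real T)\<^sup>2 * \<sigma>\<^sup>2 * C\<alpha>\<^sup>2 / (\<mu> * (1 + h + real k))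
             + 128 * (L + 1)\<^sup>2 * (real T)\<^sup>2 * \<sigma>\<^sup>2 * real f * C\<alpha>\<^sup>2
                 / ((1 + h + real k) * real (card H))"
      using harmonic_bound[of k] by (simp add: add_divide_distrib mult_ac)
  qed
qed

end
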